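(* Let $\mathbb{F}_\infty$ be the free group on infinitely many generators $\{g_i\}_{i\in\mathbb{Z}}$, and let $\alpha$ be the automorphism of the reduced group $C^*$-algebra $C^*_r(\mathbb{F}_\infty)$ induced by the free shift $g_i\mapsto g_{i+1}$ ($i\in\mathbb{Z}$) of the generators. Then $\alpha$ is $E$-strictly weak mixing with $E=\tau(\,\cdot\,)\mathbf{1}$, where $\tau$ is the canonical trace on $C^*_r(\mathbb{F}_\infty)$. That is, $$\lim_{n\to\infty}\frac1n\sum_{k=0}^{n-1}\big|\varphi(\alpha^k(x))-\tau(x)\big|=0$$ for every $x\in C^*_r(\mathbb{F}_\infty)$ and every state $\varphi$ on $C^*_r(\mathbb{F}_\infty)$.
   Context: $C^*_r(\mathbb{F}_\infty)$ is the $C^*$-algebra generated by the left regular representation $\lambda$ of $\mathbb{F}_\infty$ on $\ell^2(\mathbb{F}_\infty)$. If $\beta$ is the automorphism of $\mathbb{F}_\infty$ determined by $\beta(g_i)=g_{i+1}$ for all $i\in\mathbb{Z}$, then $\alpha$ is determined by $\alpha(\lambda_g)=\lambda_{\beta(g)}$, $g\in\mathbb{F}_\infty$. The canonical trace is $\tau(x)=\langle x\delta_e,\delta_e\rangle$, with $e$ the identity of the group. For a unital $C^*$-algebra $\mathfrak{A}$, a completely positive identity-preserving map $T:\mathfrak{A}\to\mathfrak{A}$ and a linear map $F:\mathfrak{A}\to\mathfrak{A}$, one says that $T$ (or $(\mathfrak{A},T)$) is $F$-strictly weak mixing if $\lim_n\frac1n\sum_{k=0}^{n-1}|\varphi(T^k(x))-\varphi(F(x))|=0$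 for every $x\in\mathfrak{A}$ and every state $\varphi$ on $\mathfrak{A}$. *)

theory Defs
  imports "HOL-Analysis.Analysis"
begin

section \<open>Free groups\<close>

text \<open>A letter \<open>(i, True)\<close> stands for the generator \<open>g\<^sub>i\<close> and \<open>(i, False)\<close> for its inverse.\<close>

definition inv_letter :: "'i \<times> bool \<Rightarrow> 'i \<times> bool" where
  "inv_letter a = (fst a, \<not> snd a)"

definition reduced :: "('i \<times> bool) list \<Rightarrow> bool" where
  "reduced = successively (\<lambda>a b. b \<noteq> inv_letter a)"

typedef 'i free_group = "{w :: ('i \<times> bool) list. reduced w}"
  morphisms word_of Abs_free_group
  by (rule exI[of _ "[]"]) (simp add: reduced_def)

setup_lifting type_definition_free_group

definition push :: "'i \<times> bool \<Rightarrow> ('i \<times> bool) list \<Rightarrow> ('i \<times> bool) list" where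
  "push a w = (case w of [] \<Rightarrow> [a] | b # v \<Rightarrow> if b = inv_letter a then v else a # w)"

lemma inv_letter_inv_letter [simp]: "inv_letter (inv_letter a) = a"
  by (simp add: inv_letter_def)

lemma reduced_Nil [simp]: "reduced []"
  by (simp add: reduced_def)

lemma reduced_Cons: "reduced (a # w) \<longleftrightarrow> reduced w \<and> (w = [] \<or> hd w \<noteq> inv_letter a)"
  by (cases w) (auto simp: reduced_def)

lemma reduced_push: "reduced w \<Longrightarrow> reduced (push a w)"
  by (auto simp: push_def reduced_Cons split: list.splits)

lemma reduced_foldr_push: "reduced w \<Longrightarrow> reduced (foldr push u w)"
  by (induction u) (auto intro: reduced_push)

lemma push_inv_letter: "reduced w \<Longrightarrow> push a (push (inv_letter a) w) = w"
  by (auto simp: push_def reduced_Cons split: list.splits)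

lemma foldr_push_push:
  "reduced w \<Longrightarrow> foldr push (push a v) w = push a (foldr push v w)"
  by (cases v) (auto simp: push_def[of a "[]"] push_def[of a "_ # _"] push_inv_letter reduced_foldr_push)

lemma foldr_push_assoc:
  "reduced w \<Longrightarrow> foldr push (foldr push u v) w = foldr push u (foldr push v w)"
  by (induction u) (auto simp: foldr_push_push)

lemma foldr_push_Nil: "reduced u \<Longrightarrow> foldr push u [] = u"
  by (induction u) (auto simp: reduced_Cons push_def split: list.splits)

lemma push_inv_Cons: "push (inv_letter a) (a # u) = u"
  by (simp add: push_def)

lemma foldr_push_inverse: "foldr push (rev (map inv_letter u)) u = []"
  by (induction u) (auto simp: push_inv_Cons)

lemma reduced_inverse: "reduced u \<Longrightarrow> reduced (rev (map inv_letter u))"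
  unfolding reduced_def successively_rev successively_map
  by (erule successively_mono) (auto simp: inv_letter_def)

text \<open>
  The class \<^class>\<open>group_add\<close> is the library's class of not necessarily commutative groups, so
  the group law is written additively: \<open>g + h\<close> is the concatenation of \<open>g\<close> and \<open>h\<close> followed by
  free reduction, \<open>0\<close> is the empty word and \<open>- g\<close> is the inverse of \<open>g\<close>.
\<close>

instantiation free_group :: (type) group_add
begin

lift_definition zero_free_group :: "'a free_group" is "[]"
  by simp

lift_definition plus_free_group :: "'a free_group \<Rightarrow> 'a free_group \<Rightarrow> 'a free_group"
  is "\<lambda>u v. foldr push u v"
  by (rule reduced_foldr_push)

lift_definition uminus_free_group :: "'a free_group \<Rightarrow> 'a free_group"
  is "\<lambda>u. rev (map inv_letter u)"
  by (rule reduced_inverse)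

definition minus_free_group :: "'a free_group \<Rightarrow> 'a free_group \<Rightarrow> 'a free_group" where
  "minus_free_group g h = g + - h"

instance
proof
  fix a b c :: "'a free_group"
  show "a + b + c = a + (b + c)"
    by transfer (rule foldr_push_assoc)
  show "0 + a = a"
    by transfer simp
  show "a + 0 = a"
    by transfer (rule foldr_push_Nil)
  show "- a + a = 0"
    by transfer (rule foldr_push_inverse)
  show "a + - b = a - b"
    by (simp add: minus_free_group_def)
qed

end

lift_definition gen :: "'i \<Rightarrow> 'i free_group" is "\<lambda>i. [(i, True)]"
  by (simp add: reduced_def)

definition eval_letter :: "('i \<Rightarrow> 'g::group_add) \<Rightarrow> 'i \<times> bool \<Rightarrow> 'g" where
  "eval_letter f a = (if snd a then f (fst a) else - f (fst a))"

definition free_group_lift :: "('i \<Rightarrow> 'g::group_add) \<Rightarrow> 'i free_group \<Rightarrow> 'g" where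
  "free_group_lift f g = sum_list (map (eval_letter f) (word_of g))"

lemma eval_letter_inv_letter [simp]: "eval_letter f (inv_letter a) = - eval_letter f a"
  by (simp add: eval_letter_def inv_letter_def)

lemma eval_push:
  "sum_list (map (eval_letter f) (push a w)) = eval_letter f a + sum_list (map (eval_letter f) w)"
  by (auto simp: push_def simp flip: add.assoc split: list.splits)

lemma eval_foldr_push:
  "sum_list (map (eval_letter f) (foldr push u v)) =
     sum_list (map (eval_letter f) u) + sum_list (map (eval_letter f) v)"
  by (induction u) (auto simp: eval_push add.assoc)

text \<open>Existence and uniqueness in the universal property of the free group.\<close>

lemma free_group_lift_add: "free_group_lift f (g + h) = free_group_lift f g + free_group_lift f h"
  by (simp add: free_group_lift_def plus_free_group.rep_eq eval_foldr_push)

lemma free_group_lift_gen [simp]: "free_group_lift f (gen i) = f i"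
  by (simp add: free_group_lift_def gen.rep_eq eval_letter_def)

lemma hom_zero_minus:
  fixes p :: "'a::group_add \<Rightarrow> 'b::group_add"
  assumes "\<And>g h. p (g + h) = p g + p h"
  shows "p 0 = 0" and "p (- g) = - p g"
proof -
  show "p 0 = 0"
    using assms[of 0 0] by (metis add.right_neutral add_left_cancel)
  then show "p (- g) = - p g"
    using assms[of "- g" g] by (simp add: eq_neg_iff_add_eq_0)
qed

lemma free_group_hom_unique:
  fixes p q :: "'i free_group \<Rightarrow> 'g::group_add"
  assumes p: "\<And>g h. p (g + h) = p g + p h" and q: "\<And>g h. q (g + h) = q g + q h"
    and gen: "\<And>i. p (gen i) = q (gen i)"
  shows "p = q"
proof
  note zero = hom_zero_minus(1)[OF p] hom_zero_minus(1)[OF q]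
  note minus = hom_zero_minus(2)[OF p] hom_zero_minus(2)[OF q]
  have letter: "p (Abs_free_group [a]) = q (Abs_free_group [a])" for a
  proof (cases "snd a")
    case True
    then have "Abs_free_group [a] = gen (fst a)"
      by (cases a) (simp add: gen_def)
    then show ?thesis by (simp add: gen)
  next
    case False
    then have "Abs_free_group [a] = - gen (fst a)"
      by (cases a) (simp add: gen_def uminus_free_group_def inv_letter_def
          Abs_free_group_inverse reduced_def)
    then show ?thesis by (simp add: minus gen)
  qed
  have "reduced w \<Longrightarrow> p (Abs_free_group w) = q (Abs_free_group w)" for w
  proof (induction w)
    case Nil
    then show ?case by (simp add: zero flip: zero_free_group_def)
  next
    case (Cons a w)
    then have w: "reduced w" and "push a w = a # w"
      by (auto simp: reduced_Cons push_def split: list.splits)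
    then have "Abs_free_group (a # w) = Abs_free_group [a] + Abs_free_group w"
      by (simp add: plus_free_group_def Abs_free_group_inverse reduced_Cons)
    then show ?case
      using Cons.IH[OF w] letter[of a] by (simp add: p q)
  qed
  then show "p g = q g" for g
    using word_of[of g] by (metis mem_Collect_eq word_of_inverse)
qed

text \<open>The automorphism of the free group on \<open>\<int>\<close>-indexed generators with
  \<open>g\<^sub>i \<mapsto> g\<^bsub>i+1\<^esub>\<close>.\<close>

definition free_shift :: "int free_group \<Rightarrow> int free_group" where
  "free_shift = free_group_lift (\<lambda>i. gen (i + 1))"

lemma free_shift_gen: "free_shift (gen i) = gen (i + 1)"
  by (simp add: free_shift_def)

lemma free_shift_add: "free_shift (g + h) = free_shift g + free_shift h"
  by (simp add: free_shift_def free_group_lift_add)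

lemma bij_free_shift: "bij free_shift"
proof -
  define q :: "int free_group \<Rightarrow> int free_group" where
    "q = free_group_lift (\<lambda>i. gen (i - 1))"
  have 1: "free_shift \<circ> q = id"
    by (rule free_group_hom_unique) (simp_all add: free_shift_def q_def free_group_lift_add)
  have 2: "q \<circ> free_shift = id"
    by (rule free_group_hom_unique) (simp_all add: free_shift_def q_def free_group_lift_add)
  show ?thesis
    using 1 2 by (rule o_bij[rotated])
qed


section \<open>The Hilbert space of square-summable families\<close>

definition square_summable :: "('a \<Rightarrow> complex) \<Rightarrow> bool" where
  "square_summable x \<longleftrightarrow> (\<lambda>i. (cmod (x i))\<^sup>2) summable_on UNIV"

lemma square_summable_mult:
  assumes "square_summable x" "square_summable y"
  shows "(\<lambda>i. norm (x i * cnj (y i))) summable_on UNIV"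
proof (rule abs_summable_product)
  show "(\<lambda>i. norm (x i * x i)) summable_on UNIV"
    using assms(1) by (simp add: square_summable_def norm_mult power2_eq_square)
  show "(\<lambda>i. norm (cnj (y i) * cnj (y i))) summable_on UNIV"
    using assms(2) by (simp add: square_summable_def norm_mult power2_eq_square)
qed

lemma square_summable_cmult:
  assumes "square_summable x"
  shows "square_summable (\<lambda>i. c * x i)"
  using assms unfolding square_summable_def norm_mult power_mult_distrib
  by (rule summable_on_cmult_right)

lemma square_summable_add:
  assumes "square_summable x" "square_summable y"
  shows "square_summable (\<lambda>i. x i + y i)"
proof -
  have "(\<lambda>i. (cmod (x i + y i))\<^sup>2) summable_on UNIV"
  proof (rule summable_on_comparison_test)
    show "(\<lambda>i. 2 * (cmod (x i))\<^sup>2 + 2 * (cmod (y i))\<^sup>2) summable_on UNIV"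
      using assms unfolding square_summable_def
      by (intro summable_on_add summable_on_cmult_right)
    fix i
    have "(cmod (x i + y i))\<^sup>2 \<le> (cmod (x i) + cmod (y i))\<^sup>2"
      by (intro power_mono norm_triangle_ineq) simp
    also have "\<dots> \<le> 2 * (cmod (x i))\<^sup>2 + 2 * (cmod (y i))\<^sup>2"
      using sum_squares_bound[of "cmod (x i)" "cmod (y i)"] by (simp add: power2_sum)
    finally show "(cmod (x i + y i))\<^sup>2 \<le> 2 * (cmod (x i))\<^sup>2 + 2 * (cmod (y i))\<^sup>2" .
  qed auto
  then show ?thesis by (simp add: square_summable_def)
qed

lemma square_summable_zero: "square_summable (\<lambda>_. 0)"
  by (simp add: square_summable_def)

lemma square_summable_comp:
  assumes "square_summable x" "inj p"
  shows "square_summable (\<lambda>i. x (p i))"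
proof -
  have "(\<lambda>i. (cmod (x i))\<^sup>2) summable_on range p"
    using assms(1) summable_on_subset_banach[of _ UNIV "range p"]
    by (auto simp: square_summable_def)
  then show ?thesis
    using summable_on_reindex[of p UNIV "\<lambda>i. (cmod (x i))\<^sup>2"] assms(2)
    by (simp add: square_summable_def o_def)
qed

typedef 'a ell2 = "{x :: 'a \<Rightarrow> complex. square_summable x}"
  morphisms coord Abs_ell2
  using square_summable_zero by auto

setup_lifting type_definition_ell2

lemma square_summable_coord [simp]: "square_summable (coord x)"
  using coord by auto

lemma ell2_eqI: "(\<And>i. coord x i = coord y i) \<Longrightarrow> x = y"
  using coord_inject by blast

definition cinner :: "'a ell2 \<Rightarrow> 'a ell2 \<Rightarrow> complex" where
  "cinner x y = (\<Sum>\<^sub>\<infinity>i. coord x i * cnj (coord y i))"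

lift_definition cscale :: "complex \<Rightarrow> 'a ell2 \<Rightarrow> 'a ell2" is "\<lambda>c x i. c * x i"
  by (rule square_summable_cmult)

lift_definition basis_vec :: "'a \<Rightarrow> 'a ell2" is "\<lambda>i j. if j = i then 1 else 0"
proof -
  fix i :: 'a
  have "(\<lambda>j. (cmod (if j = i then 1 else 0))\<^sup>2) summable_on {i}"
    by simp
  then show "square_summable (\<lambda>j. if j = i then 1 else (0::complex))"
    unfolding square_summable_def
    by (rule summable_on_cong_neutral[THEN iffD1, rotated -1]) auto
qed

instantiation ell2 :: (type) real_vector
begin

lift_definition zero_ell2 :: "'a ell2" is "\<lambda>_. 0"
  by (rule square_summable_zero)

lift_definition plus_ell2 :: "'a ell2 \<Rightarrow> 'a ell2 \<Rightarrow> 'a ell2" is "\<lambda>x y i. x i + y i"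
  by (rule square_summable_add)

lift_definition uminus_ell2 :: "'a ell2 \<Rightarrow> 'a ell2" is "\<lambda>x i. - x i"
  by (simp add: square_summable_def)

lift_definition minus_ell2 :: "'a ell2 \<Rightarrow> 'a ell2 \<Rightarrow> 'a ell2" is "\<lambda>x y i. x i - y i"
  subgoal for x y
    using square_summable_add[of x "\<lambda>i. - y i"] by (simp add: square_summable_def)
  done

lift_definition scaleR_ell2 :: "real \<Rightarrow> 'a ell2 \<Rightarrow> 'a ell2" is "\<lambda>r x i. complex_of_real r * x i"
  by (rule square_summable_cmult)

instance
proof
  fix x y z :: "'a ell2" and r s :: real
  show "x + y + z = x + (y + z)" "x + y = y + x" "0 + x = x" "- x + x = 0" "x - y = x + - y"
    by (transfer; simp add: algebra_simps)+
  show "r *\<^sub>R (x + y) = r *\<^sub>R x + r *\<^sub>R y" "(r + s) *\<^sub>R x = r *\<^sub>R x + s *\<^sub>R x"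
    "r *\<^sub>R s *\<^sub>R x = (r * s) *\<^sub>R x" "1 *\<^sub>R x = x"
    by (transfer; simp add: algebra_simps)+
qed

end

text \<open>As a real inner product space, \<open>\<ell>\<^sup>2\<close> carries \<^term>\<open>\<lambda>x y. Re (cinner x y)\<close>; the induced
  norm is the usual \<open>\<ell>\<^sup>2\<close>-norm.\<close>

instantiation ell2 :: (type) real_inner
begin

definition inner_ell2 :: "'a ell2 \<Rightarrow> 'a ell2 \<Rightarrow> real" where
  "inner_ell2 x y = Re (cinner x y)"

definition norm_ell2 :: "'a ell2 \<Rightarrow> real" where
  "norm_ell2 x = sqrt (inner x x)"

definition sgn_ell2 :: "'a ell2 \<Rightarrow> 'a ell2" where
  "sgn_ell2 x = x /\<^sub>R norm x"

definition dist_ell2 :: "'a ell2 \<Rightarrow> 'a ell2 \<Rightarrow> real" where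
  "dist_ell2 x y = norm (x - y)"

definition uniformity_ell2 :: "('a ell2 \<times> 'a ell2) filter" where
  "uniformity_ell2 = (INF e\<in>{0<..}. principal {(x, y). dist x y < e})"

definition open_ell2 :: "'a ell2 set \<Rightarrow> bool" where
  "open_ell2 U \<longleftrightarrow> (\<forall>x\<in>U. \<forall>\<^sub>F (x', y) in uniformity. x' = x \<longrightarrow> y \<in> U)"

lemma cinner_summable: "(\<lambda>i. coord x i * cnj (coord y i)) summable_on UNIV"
  by (rule abs_summable_summable) (simp add: square_summable_mult)

lemma cinner_add_left: "cinner (x + y) z = cinner x z + cinner y z"
  by (simp add: cinner_def plus_ell2.rep_eq ring_distribs infsum_add cinner_summable)

lemma cinner_cscale_left: "cinner (cscale c x) y = c * cinner x y"
  by (simp add: cinner_def cscale.rep_eq mult.assoc infsum_cmult_right cinner_summable)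

lemma cinner_commute: "cinner x y = cnj (cinner y x)"
  by (simp add: cinner_def mult.commute flip: infsum_cnj)

lemma scaleR_eq_cscale: "r *\<^sub>R x = cscale (complex_of_real r) (x :: 'a ell2)"
  by transfer simp

lemma cinner_self: "cinner x x = complex_of_real (\<Sum>\<^sub>\<infinity>i. (cmod (coord x i))\<^sup>2)"
  unfolding cinner_def complex_norm_square[symmetric]
  using has_sum_infsum[of "\<lambda>i. (cmod (coord x i))\<^sup>2" UNIV] square_summable_coord[of x]
  by (intro infsumI) (simp only: has_sum_of_real_iff square_summable_def)

instance
proof
  fix x y z :: "'a ell2" and r s :: real
  show "sgn x = x /\<^sub>R norm x" "dist x y = norm (x - y)" "norm x = sqrt (inner x x)"
    by (simp_all add: sgn_ell2_def dist_ell2_def norm_ell2_def)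
  show "uniformity = (INF e\<in>{0<..}. principal {(x::'a ell2, y). dist x y < e})"
    by (rule uniformity_ell2_def)
  show "open U \<longleftrightarrow> (\<forall>x\<in>U. \<forall>\<^sub>F (x', y) in uniformity. x' = x \<longrightarrow> y \<in> U)" for U :: "'a ell2 set"
    by (rule open_ell2_def)
  show "inner x y = inner y x"
    by (subst (1 2) inner_ell2_def, subst cinner_commute) simp
  show "inner (x + y) z = inner x z + inner y z"
    by (simp add: inner_ell2_def cinner_add_left)
  show "inner (r *\<^sub>R x) y = r * inner x y"
    by (simp add: inner_ell2_def scaleR_eq_cscale cinner_cscale_left)
  show "0 \<le> inner x x"
    by (simp add: inner_ell2_def cinner_self infsum_nonneg)
  show "inner x x = 0 \<longleftrightarrow> x = 0"
  proof
    assume "inner x x = 0"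
    then have "(\<Sum>\<^sub>\<infinity>i. (cmod (coord x i))\<^sup>2) = 0"
      by (simp add: inner_ell2_def cinner_self)
    then have "(cmod (coord x i))\<^sup>2 = 0" for i
      using nonneg_infsum_le_0D[of "\<lambda>i. (cmod (coord x i))\<^sup>2" UNIV i]
        square_summable_coord[of x] by (simp add: square_summable_def)
    then show "x = 0"
      by (intro ell2_eqI) (simp add: zero_ell2.rep_eq)
  qed (simp add: inner_ell2_def cinner_def zero_ell2.rep_eq)
qed

end

lemma norm_ell2_sq: "(norm x)\<^sup>2 = (\<Sum>\<^sub>\<infinity>i. (cmod (coord x i))\<^sup>2)"
  using cinner_self[of x]
  by (simp add: norm_eq_sqrt_inner inner_ell2_def infsum_nonneg)


section \<open>Bounded operators\<close>

type_synonym 'a op = "'a ell2 \<Rightarrow>\<^sub>L 'a ell2"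

text \<open>The type \<^typ>\<open>'a op\<close> consists of the bounded \<^emph>\<open>real\<close>-linear operators, with the operator
  norm; \<open>B(\<ell>\<^sup>2)\<close> is the set of those that are complex linear.\<close>

definition bounded_ops :: "'a op set" where
  "bounded_ops = {a. \<forall>c x. blinfun_apply a (cscale c x) = cscale c (blinfun_apply a x)}"

lemma cinner_add_right: "cinner x (y + z) = cinner x y + cinner x z"
  using cinner_add_left[of y z x] by (simp add: cinner_commute[of x])

lemma cinner_cscale_right: "cinner x (cscale c y) = cnj c * cinner x y"
  using cinner_cscale_left[of c y x] by (simp add: cinner_commute[of x])

lemma norm_cscale: "norm (cscale c x) = cmod c * norm x"
proof -
  have "cinner (cscale c x) (cscale c x) = c * cnj c * cinner x x"
    by (simp add: cinner_cscale_left cinner_cscale_right)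
  then have "cinner (cscale c x) (cscale c x) = complex_of_real ((cmod c)\<^sup>2) * cinner x x"
    by (simp only: complex_norm_square)
  then show ?thesis
    by (simp add: norm_eq_sqrt_inner inner_ell2_def real_sqrt_mult)
qed

lemma bounded_linear_cscale: "bounded_linear (cscale c)"
proof (rule bounded_linear_intro[where K = "cmod c"])
  show "cscale c (x + y) = cscale c x + cscale c y" for x y :: "'a ell2"
    by transfer (simp add: ring_distribs)
  show "cscale c (r *\<^sub>R x) = r *\<^sub>R cscale c x" for r and x :: "'a ell2"
    by transfer (simp add: algebra_simps)
qed (simp add: norm_cscale mult.commute)

lift_definition scalar_op :: "complex \<Rightarrow> 'a op" is cscale
  by (rule bounded_linear_cscale)

definition cscale_op :: "complex \<Rightarrow> 'a op \<Rightarrow> 'a op"  (infixr "*\<^sub>O" 75) where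
  "c *\<^sub>O a = scalar_op c o\<^sub>L a"

definition adj :: "'a op \<Rightarrow> 'a op" where
  "adj a = (THE b :: 'a op. \<forall>x y. cinner (a x) y = cinner x (b y))"

text \<open>The adjoint of every \<^prop>\<open>a \<in> bounded_ops\<close> exists (the lemma \<open>cinner_adj\<close>).\<close>

lemma cmod_cinner_le: "cmod (cinner x y) \<le> norm x * norm y"
proof -
  define c where "c = cnj (sgn (cinner x y))"
  have c: "cmod c \<le> 1"
    by (simp add: c_def norm_sgn)
  have "c * cinner x y = complex_of_real (cmod (cinner x y))"
    by (cases "cinner x y = 0")
      (simp_all add: c_def sgn_eq field_simps complex_norm_square[symmetric] power2_eq_square
        mult.commute[of "cnj _"])
  then have "cmod (cinner x y) = inner (cscale c x) y"
    by (simp add: inner_ell2_def cinner_cscale_left)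
  also have "\<dots> \<le> norm (cscale c x) * norm y"
    by (rule norm_cauchy_schwarz)
  also have "\<dots> \<le> norm x * norm y"
    using c by (intro mult_right_mono) (auto simp: norm_cscale mult_left_le_one_le)
  finally show ?thesis .
qed

lemma cinner_basis_vec_left: "cinner (basis_vec i) x = cnj (coord x i)"
proof -
  have "cinner (basis_vec i) x = (\<Sum>\<^sub>\<infinity>j\<in>{i}. cnj (coord x i))"
    unfolding cinner_def basis_vec.rep_eq by (rule infsum_cong_neutral) auto
  then show ?thesis by simp
qed

lemma cinner_eqI: "(\<And>z. cinner z x = cinner z y) \<Longrightarrow> x = y"
  by (rule ell2_eqI) (metis cinner_basis_vec_left complex_cnj_cnj)

lemma coord_sum: "coord (\<Sum>i\<in>F. f i) j = (\<Sum>i\<in>F. coord (f i) j)"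
  by (induction F rule: infinite_finite_induct)
    (simp_all add: zero_ell2.rep_eq plus_ell2.rep_eq)

lemma ell2_approx:
  assumes "e > 0"
  shows "\<exists>F. finite F \<and> norm (x - (\<Sum>i\<in>F. cscale (coord x i) (basis_vec i))) < e"
proof -
  let ?f = "\<lambda>i. (cmod (coord x i))\<^sup>2"
  have summable: "?f summable_on UNIV"
    using square_summable_coord[of x] by (simp add: square_summable_def)
  then have "(sum ?f \<longlongrightarrow> infsum ?f UNIV) (finite_subsets_at_top UNIV)"
    using has_sum_infsum[OF summable] by (simp add: has_sum_def)
  moreover have "e\<^sup>2 > 0"
    using assms by simp
  ultimately have "\<forall>\<^sub>F F in finite_subsets_at_top UNIV. dist (sum ?f F) (infsum ?f UNIV) < e\<^sup>2"
    by (rule tendstoD)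
  then obtain F where F: "finite F" "dist (sum ?f F) (infsum ?f UNIV) < e\<^sup>2"
    by (auto simp: eventually_finite_subsets_at_top)
  let ?z = "\<Sum>i\<in>F. cscale (coord x i) (basis_vec i)"
  have z: "coord ?z j = (if j \<in> F then coord x j else 0)" for j
    using F(1) by (simp add: coord_sum cscale.rep_eq basis_vec.rep_eq if_distrib cong: if_cong)
  have "(norm (x - ?z))\<^sup>2 = infsum ?f (UNIV - F)"
    unfolding norm_ell2_sq by (rule infsum_cong_neutral) (auto simp: minus_ell2.rep_eq z)
  also have "\<dots> = infsum ?f UNIV - sum ?f F"
    using infsum_Diff[OF summable, of F] F(1) by simp
  also have "\<dots> < e\<^sup>2"
    using F(2) by (simp add: dist_real_def)
  finally have "norm (x - ?z) < e"
    using assms by (simp add: power2_less_imp_less)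
  then show ?thesis
    using F(1) by blast
qed

lemma ell2_bounded_linear_eq_0:
  assumes D: "bounded_linear D" and 0: "\<And>c i. D (cscale c (basis_vec i)) = 0"
  shows "D x = 0"
proof (rule ccontr)
  assume nz: "D x \<noteq> 0"
  interpret D: bounded_linear D by fact
  obtain K where K: "K > 0" "\<And>x. norm (D x) \<le> norm x * K"
    using D.pos_bounded by blast
  define e where "e = norm (D x) / K"
  have "e > 0"
    using nz K(1) by (simp add: e_def)
  then obtain F where F: "norm (x - (\<Sum>i\<in>F. cscale (coord x i) (basis_vec i))) < e"
    using ell2_approx by blast
  have "D (x - (\<Sum>i\<in>F. cscale (coord x i) (basis_vec i))) = D x"
    by (simp add: D.diff D.sum 0)
  then have "norm (D x) \<le> norm (x - (\<Sum>i\<in>F. cscale (coord x i) (basis_vec i))) * K"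
    using K(2) by metis
  also have "\<dots> < e * K"
    using F K(1) by simp
  also have "\<dots> = norm (D x)"
    using K(1) by (simp add: e_def)
  finally show False by simp
qed

lemma bounded_linear_cinner_left: "bounded_linear (\<lambda>x. cinner x y)"
proof (rule bounded_linear_intro[where K = "norm y"])
  show "cinner (r *\<^sub>R x) y = r *\<^sub>R cinner x y" for r x
    by (simp add: scaleR_eq_cscale cinner_cscale_left scaleR_conv_of_real)
qed (simp_all add: cinner_add_left cmod_cinner_le)

lemma adjoint_exists:
  assumes a: "a \<in> bounded_ops"
  shows "\<exists>b :: 'a op. \<forall>x y. cinner (a x) y = cinner x (b y)"
proof -
  have bound: "(\<Sum>i\<in>F. (cmod (cinner y (a (basis_vec i))))\<^sup>2) \<le> (norm a * norm y)\<^sup>2"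
    if F: "finite F" for F y
  proof -
    define c where "c i = cinner y (a (basis_vec i))" for i
    define z where "z = (\<Sum>i\<in>F. cscale (c i) (basis_vec i))"
    define S where "S = (\<Sum>i\<in>F. (cmod (c i))\<^sup>2)"
    have S0: "S \<ge> 0"
      by (simp add: S_def sum_nonneg)
    have z: "coord z j = (if j \<in> F then c j else 0)" for j
      using F by (simp add: z_def coord_sum cscale.rep_eq basis_vec.rep_eq if_distrib cong: if_cong)
    have "(norm z)\<^sup>2 = infsum (\<lambda>i. (cmod (c i))\<^sup>2) F"
      unfolding norm_ell2_sq by (rule infsum_cong_neutral) (auto simp: z)
    then have nz: "norm z = sqrt S"
      using F by (simp add: S_def real_sqrt_unique)
    have az: "a z = (\<Sum>i\<in>F. cscale (c i) (a (basis_vec i)))"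
      using a by (simp add: z_def blinfun.sum_right bounded_ops_def)
    interpret L: bounded_linear "\<lambda>x. cinner x y" by (rule bounded_linear_cinner_left)
    have "cinner (a z) y = (\<Sum>i\<in>F. c i * cnj (c i))"
      by (simp add: az L.sum cinner_cscale_left c_def cinner_commute[of "a _" y])
    then have "cinner (a z) y = complex_of_real S"
      by (simp add: S_def complex_norm_square del: of_real_power)
    then have "S = cmod (cinner (a z) y)"
      using S0 by simp
    also have "\<dots> \<le> norm (a z) * norm y"
      by (rule cmod_cinner_le)
    also have "\<dots> \<le> norm a * norm z * norm y"
      by (intro mult_right_mono norm_blinfun) simp
    finally have "sqrt S * sqrt S \<le> (norm a * norm y) * sqrt S"
      using S0 by (simp add: nz mult_ac)
    then have "sqrt S \<le> norm a * norm y"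
      using S0 mult_right_le_imp_le[of "sqrt S" "sqrt S" "norm a * norm y"]
    by (cases "S = 0") auto
    then have "(sqrt S)\<^sup>2 \<le> (norm a * norm y)\<^sup>2"
      using S0 by (intro power_mono) auto
    then show ?thesis
      using S0 by (simp add: S_def c_def)
  qed
  have ss: "square_summable (\<lambda>i. cinner y (a (basis_vec i)))" for y
    unfolding square_summable_def
    by (rule nonneg_bdd_above_summable_on) (auto intro!: bdd_aboveI bound)
  define b where "b y = Abs_ell2 (\<lambda>i. cinner y (a (basis_vec i)))" for y
  have b: "coord (b y) i = cinner y (a (basis_vec i))" for y i
    using ss by (simp add: b_def Abs_ell2_inverse)
  have bl: "bounded_linear b"
  proof (rule bounded_linear_intro[where K = "norm a"])
    show "b (x + y) = b x + b y" for x y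
      by (rule ell2_eqI) (simp add: b plus_ell2.rep_eq cinner_add_left)
    show "b (r *\<^sub>R x) = r *\<^sub>R b x" for r x
      by (rule ell2_eqI) (simp add: b scaleR_eq_cscale cscale.rep_eq cinner_cscale_left)
    fix y
    have "(norm (b y))\<^sup>2 \<le> (norm a * norm y)\<^sup>2"
      unfolding norm_ell2_sq b using ss[of y]
      by (intro infsum_le_finite_sums) (auto simp: square_summable_def intro: bound)
    then show "norm (b y) \<le> norm y * norm a"
      by (metis mult.commute mult_nonneg_nonneg norm_ge_zero power2_le_imp_le)
  qed
  have "cinner (a x) y - cinner x (b y) = 0" for x y
  proof (rule ell2_bounded_linear_eq_0[where D = "\<lambda>x. cinner (a x) y - cinner x (b y)"])
    show "bounded_linear (\<lambda>x. cinner (a x) y - cinner x (b y))"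
      by (intro bounded_linear_sub bounded_linear_cinner_left
          bounded_linear_compose[OF bounded_linear_cinner_left] blinfun.bounded_linear_right)
    show "cinner (a (cscale c (basis_vec i))) y - cinner (cscale c (basis_vec i)) (b y) = 0" for c i
      using a cinner_commute[of y "a (basis_vec i)"]
      by (simp add: bounded_ops_def cinner_cscale_left cinner_basis_vec_left b)
  qed
  then have "\<forall>x y. cinner (a x) y = cinner x (Blinfun b y)"
    using bl by (simp add: bounded_linear_Blinfun_apply)
  then show ?thesis by blast
qed

lemma adj_eqI:
  fixes a b :: "'a op"
  assumes "\<And>x y. cinner (a x) y = cinner x (b y)"
  shows "adj a = b"
  unfolding adj_def
proof (rule the_equality)
  fix b' :: "'a op"
  assume "\<forall>x y. cinner (a x) y = cinner x (b' y)"
  with assms show "b' = b"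
    by (intro blinfun_eqI cinner_eqI) metis
qed (use assms in blast)

lemma cinner_adj:
  assumes "a \<in> bounded_ops"
  shows "cinner (a x) y = cinner x (adj a y)"
proof -
  obtain b :: "'a op" where b: "\<forall>x y. cinner (a x) y = cinner x (b y)"
    using adjoint_exists[OF assms] by blast
  then have "adj a = b"
    by (intro adj_eqI) blast
  with b show ?thesis by simp
qed

lemma adj_in_bounded_ops:
  assumes "a \<in> bounded_ops"
  shows "adj a \<in> bounded_ops"
  unfolding bounded_ops_def
  by (auto intro!: cinner_eqI simp: cinner_cscale_right simp flip: cinner_adj[OF assms])


section \<open>C*-algebras of operators\<close>

definition cstar_subalgebra :: "'a op set \<Rightarrow> bool" where
  "cstar_subalgebra A \<longleftrightarrow>
     A \<subseteq> bounded_ops \<and> closed A \<and> 0 \<in> A \<and>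
     (\<forall>a\<in>A. \<forall>b\<in>A. a + b \<in> A \<and> a o\<^sub>L b \<in> A) \<and>
     (\<forall>c. \<forall>a\<in>A. c *\<^sub>O a \<in> A) \<and>
     (\<forall>a\<in>A. adj a \<in> A)"

definition alg_linear :: "'a op set \<Rightarrow> ('a op \<Rightarrow> 'a op) \<Rightarrow> bool" where
  "alg_linear A T \<longleftrightarrow>
     (\<forall>a\<in>A. T a \<in> A) \<and>
     (\<forall>a\<in>A. \<forall>b\<in>A. T (a + b) = T a + T b) \<and>
     (\<forall>c. \<forall>a\<in>A. T (c *\<^sub>O a) = c *\<^sub>O T a)"

definition star_automorphism :: "'a op set \<Rightarrow> ('a op \<Rightarrow> 'a op) \<Rightarrow> bool" where
  "star_automorphism A \<alpha> \<longleftrightarrow>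
     bij_betw \<alpha> A A \<and> alg_linear A \<alpha> \<and>
     (\<forall>a\<in>A. \<forall>b\<in>A. \<alpha> (a o\<^sub>L b) = \<alpha> a o\<^sub>L \<alpha> b) \<and>
     (\<forall>a\<in>A. \<alpha> (adj a) = adj (\<alpha> a))"

definition state :: "'a op set \<Rightarrow> ('a op \<Rightarrow> complex) \<Rightarrow> bool" where
  "state A \<phi> \<longleftrightarrow>
     (\<forall>a\<in>A. \<forall>b\<in>A. \<phi> (a + b) = \<phi> a + \<phi> b) \<and>
     (\<forall>c. \<forall>a\<in>A. \<phi> (c *\<^sub>O a) = c * \<phi> a) \<and>
     (\<forall>a\<in>A. \<phi> (adj a o\<^sub>L a) \<in> \<real>\<^sub>\<ge>\<^sub>0) \<and>
     \<phi> id_blinfun = 1"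

text \<open>The matrix \<open>(X\<^sub>i\<^sub>j)\<close>, with \<open>i, j < n\<close>, is a positive element \<open>B\<^sup>*B\<close> of the C*-algebra of
  \<open>n \<times> n\<close> matrices over \<open>A\<close>.\<close>

definition positive_matrix :: "'a op set \<Rightarrow> nat \<Rightarrow> (nat \<Rightarrow> nat \<Rightarrow> 'a op) \<Rightarrow> bool" where
  "positive_matrix A n X \<longleftrightarrow>
     (\<exists>B. (\<forall>i<n. \<forall>j<n. B i j \<in> A) \<and>
          (\<forall>i<n. \<forall>j<n. X i j = (\<Sum>k<n. adj (B k i) o\<^sub>L B k j)))"

definition completely_positive :: "'a op set \<Rightarrow> ('a op \<Rightarrow> 'a op) \<Rightarrow> bool" where
  "completely_positive A T \<longleftrightarrow>
     alg_linear A T \<and>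
     (\<forall>n X. positive_matrix A n X \<longrightarrow> positive_matrix A n (\<lambda>i j. T (X i j)))"

text \<open>The first two lines are the standing assumptions on a unital C*-algebra \<open>A\<close> and maps \<open>T\<close>
  and \<open>F\<close> under which the notion is defined.\<close>

definition strictly_weak_mixing ::
    "'a op set \<Rightarrow> ('a op \<Rightarrow> 'a op) \<Rightarrow> ('a op \<Rightarrow> 'a op) \<Rightarrow> bool" where
  "strictly_weak_mixing A T F \<longleftrightarrow>
     cstar_subalgebra A \<and> id_blinfun \<in> A \<and>
     completely_positive A T \<and> T id_blinfun = id_blinfun \<and> alg_linear A F \<and>
     (\<forall>x\<in>A. \<forall>\<phi>. state A \<phi> \<longrightarrow>
        (\<lambda>n. (\<Sum>k<n. cmod (\<phi> ((T ^^ k) x) - \<phi> (F x))) / real n) \<longlonglongrightarrow> 0)"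

lemma cscale_op_apply: "(c *\<^sub>O a) x = cscale c (a x)"
  by (simp add: cscale_op_def scalar_op.rep_eq)

lemma cstar_subalgebra_bounded_ops: "cstar_subalgebra (bounded_ops :: 'a op set)"
proof -
  have "closed {a :: 'a op. a (cscale c x) = cscale c (a x)}" for c x
    by (intro closed_Collect_eq continuous_intros
        bounded_linear.continuous_on[OF bounded_linear_cscale])
  then have "closed (\<Inter>c x. {a :: 'a op. a (cscale c x) = cscale c (a x)})"
    by (intro closed_INT) blast
  also have "(\<Inter>c x. {a :: 'a op. a (cscale c x) = cscale c (a x)}) = bounded_ops"
    by (auto simp: bounded_ops_def)
  finally have "closed (bounded_ops :: 'a op set)" .
  moreover have "cscale c (0 :: 'a ell2) = 0" "cscale c (x + y) = cscale c x + cscale c y"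
    "cscale c (cscale d x) = cscale d (cscale c x)" for c d and x y :: "'a ell2"
    by (transfer; simp add: algebra_simps)+
  ultimately show ?thesis
    unfolding cstar_subalgebra_def
    by (intro conjI ballI allI adj_in_bounded_ops)
      (auto simp: bounded_ops_def blinfun.add_left cscale_op_apply)
qed

lemma cstar_subalgebra_hull:
  assumes "S \<subseteq> bounded_ops"
  shows "cstar_subalgebra (cstar_subalgebra hull S)"
proof -
  have "cstar_subalgebra (\<Inter>X)" if X: "\<forall>A\<in>X. cstar_subalgebra A" and ne: "X \<noteq> {}" for X :: "'a op set set"
  proof -
    obtain A0 where A0: "A0 \<in> X"
      using ne by blast
    have sub: "A \<subseteq> bounded_ops" "closed A" "0 \<in> A"
      "a \<in> A \<Longrightarrow> b \<in> A \<Longrightarrow> a + b \<in> A" "a \<in> A \<Longrightarrow> b \<in> A \<Longrightarrow> a o\<^sub>L b \<in> A"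
      "a \<in> A \<Longrightarrow> c *\<^sub>O a \<in> A" "a \<in> A \<Longrightarrow> adj a \<in> A" if "A \<in> X" for A a b c
      using bspec[OF X that] by (simp_all add: cstar_subalgebra_def)
    have "\<Inter>X \<subseteq> bounded_ops"
      using A0 sub(1)[OF A0] by (meson Inter_lower order_trans)
    then show ?thesis
      unfolding cstar_subalgebra_def
      by (intro conjI ballI allI InterI closed_Inter) (simp_all add: sub)
  qed
  moreover have "bounded_ops \<in> {A. cstar_subalgebra A \<and> S \<subseteq> A}"
    using assms cstar_subalgebra_bounded_ops by simp
  ultimately show ?thesis
    unfolding hull_def by (metis (mono_tags, lifting) empty_iff mem_Collect_eq)
qed


section \<open>The reduced group C*-algebra and its free shift\<close>

lift_definition translate :: "'g::group_add \<Rightarrow> 'g ell2 \<Rightarrow> 'g ell2" is "\<lambda>g x h. x (- g + h)"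
  by (rule square_summable_comp) (auto intro!: injI)

lemma reindex:
  assumes p: "bij p" and T: "\<And>x i. coord (T x) i = coord x (p i)"
  shows "bounded_linear T" and "cinner (T x) (T y) = cinner x y"
proof -
  show cinner: "cinner (T x) (T y) = cinner x y" for x y
    unfolding cinner_def T by (rule infsum_reindex_bij_betw[OF p])
  show "bounded_linear T"
    by (rule bounded_linear_intro[where K = 1])
      (auto intro!: ell2_eqI simp: T plus_ell2.rep_eq scaleR_ell2.rep_eq
        norm_eq_sqrt_inner inner_ell2_def cinner)
qed

lemma bij_left_translation: "bij (\<lambda>h. g + h :: 'g::group_add)"
  by (rule bijI') (auto intro: exI[of _ "- g + _"] simp flip: add.assoc)

lift_definition lreg :: "'g::group_add \<Rightarrow> 'g op" is translate
proof -
  fix g :: 'g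
  show "bounded_linear (translate g)"
    by (rule reindex(1)[where p = "\<lambda>h. - g + h"])
      (simp_all add: bij_left_translation translate.rep_eq)
qed

definition reduced_group_cstar :: "'g::group_add op set" where
  "reduced_group_cstar = cstar_subalgebra hull (range lreg)"

definition canonical_trace :: "'g::group_add op \<Rightarrow> complex" where
  "canonical_trace a = cinner (a (basis_vec 0)) (basis_vec 0)"

lemma coord_lreg: "coord (lreg g x) h = coord x (- g + h)"
  by (simp add: lreg.rep_eq translate.rep_eq)

lemma lreg_basis_vec: "lreg g (basis_vec h) = basis_vec (g + h)"
  by (rule ell2_eqI) (auto simp: coord_lreg basis_vec.rep_eq add.assoc[symmetric] neg_eq_iff_add_eq_0)

lemma lreg_add: "lreg (g + h) = lreg g o\<^sub>L lreg h"
  by (intro blinfun_eqI ell2_eqI) (simp add: coord_lreg minus_add add.assoc del: add_uminus_conv_diff)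

lemma lreg_zero: "lreg 0 = id_blinfun"
  by (intro blinfun_eqI ell2_eqI) (simp add: coord_lreg)

lemma lreg_in_bounded_ops: "lreg g \<in> bounded_ops"
  by (auto simp: bounded_ops_def coord_lreg cscale.rep_eq intro: ell2_eqI)

lemma cstar_subalgebra_reduced_group_cstar: "cstar_subalgebra reduced_group_cstar"
  unfolding reduced_group_cstar_def
  by (rule cstar_subalgebra_hull) (auto simp: lreg_in_bounded_ops)

lemma id_in_reduced_group_cstar: "id_blinfun \<in> reduced_group_cstar"
  unfolding reduced_group_cstar_def by (metis hull_inc lreg_zero rangeI)

lemma conjugation:
  fixes U V :: "'a op"
  assumes inv: "U o\<^sub>L V = id_blinfun" "V o\<^sub>L U = id_blinfun"
    and UV_adj: "\<And>x y. cinner (U x) y = cinner x (V y)"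
    and ops: "U \<in> bounded_ops" "V \<in> bounded_ops"
    and Ad_def: "Ad = (\<lambda>x. U o\<^sub>L x o\<^sub>L V)"
  shows "Ad (x + y) = Ad x + Ad y" and "Ad (x o\<^sub>L y) = Ad x o\<^sub>L Ad y"
    and "Ad (c *\<^sub>O x) = c *\<^sub>O Ad x"
    and "x \<in> bounded_ops \<Longrightarrow> Ad (adj x) = adj (Ad x)"
    and "cstar_subalgebra A \<Longrightarrow> cstar_subalgebra {x \<in> bounded_ops. Ad x \<in> A}"
proof -
  have VU: "V (U x) = x" and "U (V x) = x" for x
    using inv by (metis blinfun_apply_blinfun_compose blinfun_apply_id_blinfun)+
  then have VU_adj: "cinner (V x) y = cinner x (U y)" for x y
    using UV_adj[of "V x" "U y"] by simp
  show add: "Ad (x + y) = Ad x + Ad y" for x y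
    by (rule blinfun_eqI) (simp add: Ad_def blinfun.add_left blinfun.add_right)
  show mult: "Ad (x o\<^sub>L y) = Ad x o\<^sub>L Ad y" for x y
    by (rule blinfun_eqI) (simp add: Ad_def VU)
  show scale: "Ad (c *\<^sub>O x) = c *\<^sub>O Ad x" for c x
    using ops by (intro blinfun_eqI) (simp add: Ad_def cscale_op_apply bounded_ops_def)
  show adj: "Ad (adj x) = adj (Ad x)" if "x \<in> bounded_ops" for x
    by (rule adj_eqI[symmetric]) (simp add: Ad_def UV_adj VU_adj cinner_adj[OF that])
  assume A: "cstar_subalgebra A"
  have 0: "Ad 0 = 0"
    by (rule blinfun_eqI) (simp add: Ad_def)
  have "continuous_on UNIV Ad"
    unfolding Ad_def
    by (intro bounded_bilinear.continuous_on[OF bounded_bilinear_blinfun_compose] continuous_intros)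
  then have "closed (Ad -` A \<inter> bounded_ops)"
    using A cstar_subalgebra_bounded_ops
    by (intro closed_Int closed_vimage) (auto simp: cstar_subalgebra_def)
  then have "closed {x \<in> bounded_ops. Ad x \<in> A}"
    by (simp add: vimage_def Int_def conj_commute)
  then show "cstar_subalgebra {x \<in> bounded_ops. Ad x \<in> A}"
    using A cstar_subalgebra_bounded_ops[where 'a = 'a]
    unfolding cstar_subalgebra_def by (simp add: add mult scale adj 0)
qed

text \<open>The free shift of the generators does induce an automorphism of the reduced C*-algebra.\<close>

lemma free_shift_automorphism_exists:
  "\<exists>\<alpha>. star_automorphism reduced_group_cstar \<alpha> \<and> (\<forall>g. \<alpha> (lreg g) = lreg (free_shift g))"
proof -
  let ?A = "reduced_group_cstar :: int free_group op set"
  define q where "q = inv free_shift"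
  have q: "bij q" "free_shift (q g) = g" "q (free_shift g) = g" for g
    using bij_free_shift
    by (simp_all add: q_def bij_imp_bij_inv bij_is_surj surj_f_inv_f bij_is_inj inv_f_f)
  have q_add: "q (g + h) = q g + q h" for g h
    by (metis free_shift_add q(2,3))
  have minus: "free_shift (- g) = - free_shift g" "q (- g) = - q g" for g
    by (rule hom_zero_minus(2), rule free_shift_add) (rule hom_zero_minus(2), rule q_add)
  define u where "u p x = Abs_ell2 (\<lambda>i. coord x (p i))"
    for p :: "int free_group \<Rightarrow> int free_group" and x
  have u: "coord (u p x) i = coord x (p i)" if "bij p" for p x i
    using square_summable_comp[OF square_summable_coord bij_is_inj[OF that]]
    by (simp add: u_def Abs_ell2_inverse)
  define U where "U = Blinfun (u q)"
  define V where "V = Blinfun (u free_shift)"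
  have U: "coord (U x) i = coord x (q i)" for x i
    using reindex(1)[OF q(1) u[OF q(1)]] u[OF q(1)]
    by (simp add: U_def bounded_linear_Blinfun_apply)
  have V: "coord (V x) i = coord x (free_shift i)" for x i
    using reindex(1)[OF bij_free_shift u[OF bij_free_shift]] u[OF bij_free_shift]
    by (simp add: V_def bounded_linear_Blinfun_apply)
  have UV: "U o\<^sub>L V = id_blinfun" "V o\<^sub>L U = id_blinfun"
    by (intro blinfun_eqI ell2_eqI; simp add: U V q)+
  then have UV': "U (V x) = x" "V (U x) = x" for x
    by (metis blinfun_apply_blinfun_compose blinfun_apply_id_blinfun id_apply)+
  have adj: "cinner (U x) y = cinner x (V y)" "cinner (V x) y = cinner x (U y)" for x y
    using reindex(2)[OF q(1) U, of x "V y"] reindex(2)[OF bij_free_shift V, of x "U y"]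
    by (simp_all add: UV')
  have ops: "U \<in> bounded_ops" "V \<in> bounded_ops"
    by (auto simp: bounded_ops_def U V cscale.rep_eq intro: ell2_eqI)
  define \<alpha> where "\<alpha> = (\<lambda>x. U o\<^sub>L x o\<^sub>L V)"
  define \<beta> where "\<beta> = (\<lambda>x. V o\<^sub>L x o\<^sub>L U)"
  have lreg: "\<alpha> (lreg g) = lreg (free_shift g)" "\<beta> (lreg g) = lreg (q g)" for g
    by (intro blinfun_eqI ell2_eqI; simp add: \<alpha>_def \<beta>_def U V coord_lreg q q_add minus free_shift_add)+
  note \<alpha> = conjugation[OF UV adj(1) ops \<alpha>_def]
  note \<beta> = conjugation[OF UV(2,1) adj(2) ops(2,1) \<beta>_def]
  have inA: "lreg g \<in> ?A" for g
    unfolding reduced_group_cstar_def by (rule hull_inc) simp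
  have "?A \<subseteq> {x \<in> bounded_ops. \<alpha> x \<in> ?A}"
    unfolding reduced_group_cstar_def[where 'g = "int free_group"]
    by (rule hull_minimal; fold reduced_group_cstar_def)
      (auto simp: lreg lreg_in_bounded_ops inA \<alpha>(5)[OF cstar_subalgebra_reduced_group_cstar])
  then have \<alpha>A: "\<alpha> x \<in> ?A" if "x \<in> ?A" for x
    using that by blast
  have "?A \<subseteq> {x \<in> bounded_ops. \<beta> x \<in> ?A}"
    unfolding reduced_group_cstar_def[where 'g = "int free_group"]
    by (rule hull_minimal; fold reduced_group_cstar_def)
      (auto simp: lreg lreg_in_bounded_ops inA \<beta>(5)[OF cstar_subalgebra_reduced_group_cstar])
  then have \<beta>A: "\<beta> x \<in> ?A" if "x \<in> ?A" for x
    using that by blast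
  have "\<alpha> (\<beta> x) = x" "\<beta> (\<alpha> x) = x" for x
    by (intro blinfun_eqI; simp add: \<alpha>_def \<beta>_def UV')+
  then have "bij_betw \<alpha> ?A ?A"
    by (intro bij_betw_byWitness[where f' = \<beta>]) (auto simp: \<alpha>A \<beta>A)
  moreover have "?A \<subseteq> bounded_ops"
    using cstar_subalgebra_reduced_group_cstar by (auto simp: cstar_subalgebra_def)
  ultimately have "star_automorphism ?A \<alpha>"
    unfolding star_automorphism_def alg_linear_def by (auto simp: \<alpha>(1-4) \<alpha>A)
  with lreg show ?thesis by blast
qed

end

theory Submission
  imports Defs
begin

text \<open>
  Since \<open>\<phi> \<circ> \<alpha>\<^sup>k\<close> is again a state and states are contractive (\<open>state_le_norm\<close>), the
  functionals \<open>\<phi> \<circ> \<alpha>\<^sup>k - \<tau>\<close> are bounded by \<open>2\<close> uniformly in \<open>k\<close>. The property of having Cesaro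
  means of absolute values that tend to \<open>0\<close> therefore passes from the unitaries \<open>\<lambda>\<^sub>g\<close> to their
  linear combinations and then to norm limits, that is, to the whole reduced C*-algebra
  (\<open>cesaro_null_of_generators\<close>). For \<open>g = 0\<close> the functionals vanish at \<open>\<lambda>\<^sub>g\<close>, so let \<open>g \<noteq> 0\<close>;
  then \<open>\<tau>(\<lambda>\<^sub>g) = 0\<close>.

  Choose numbers \<open>c\<^sub>k\<close> of modulus at most \<open>1\<close> that turn \<open>\<phi>(\<alpha>\<^sup>k(\<lambda>\<^sub>g))\<close> into its absolute value.
  Contractivity of \<open>\<phi>\<close> bounds the sum of the first \<open>n\<close> absolute values by the norm of
  \<open>\<Sum>k<n. c\<^sub>k \<lambda>(\<beta>\<^sup>k g)\<close>, where \<open>\<beta>\<close> is the free shift, and this norm is at most \<open>2 \<surd>n\<close>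
  (\<open>norm_sum_lreg_shifts\<close>). Dividing by \<open>n\<close> gives a null sequence.

  The norm estimate is a ping-pong argument. Left translation by \<open>\<beta>\<^sup>k g\<close> maps every reduced word
  that does not begin with the inverse of the last letter of \<open>\<beta>\<^sup>k g\<close> to a word that begins with
  the first letter of \<open>\<beta>\<^sup>k g\<close>. For different \<open>k\<close> the excluded words, and likewise the target
  words, form disjoint sets, because the shift moves the indices of the letters. The parts of a
  vector off the excluded words therefore become pairwise orthogonal by translation, and the parts
  on the excluded words are pairwise orthogonal before it (\<open>norm_sum_lreg_ping_pong\<close>).

  Contractivity of states needs positivity of \<open>1 - h\<close> within the algebra for a self-adjoint \<open>h\<close>
  of norm less than \<open>1\<close>. The required square root comes from the Banach fixed point theorem
  (\<open>cstar_sqrt_one_minus\<close>), and so rests on the completeness of \<open>\<ell>\<^sup>2\<close>.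
\<close>

section \<open>Completeness of the Hilbert space\<close>

lemma sum_coord_le_norm:
  assumes "finite F"
  shows "(\<Sum>i\<in>F. (cmod (coord x i))\<^sup>2) \<le> (norm x)\<^sup>2"
  unfolding norm_ell2_sq using assms square_summable_coord[of x]
  by (intro finite_sum_le_infsum) (auto simp: square_summable_def)

lemma cmod_coord_le_norm: "cmod (coord x i) \<le> norm x"
  using sum_coord_le_norm[of "{i}" x] by (simp add: power2_le_iff_abs_le)

text \<open>The limit is taken coordinatewise. Bounds on finite partial sums of squares survive that
  limit, which makes it square summable and the convergence one in norm. As a consequence, the
  space of bounded operators on \<open>\<ell>\<^sup>2\<close> is complete as well.\<close>

instance ell2 :: (type) banach
proof
  fix X :: "nat \<Rightarrow> 'a ell2"
  assume X: "Cauchy X"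
  have "Cauchy (\<lambda>n. coord (X n) i)" for i
  proof (rule metric_CauchyI)
    fix e :: real
    assume "e > 0"
    then obtain N where "\<And>m n. m \<ge> N \<Longrightarrow> n \<ge> N \<Longrightarrow> dist (X m) (X n) < e"
      using X by (meson metric_CauchyD)
    moreover have "dist (coord (X m) i) (coord (X n) i) \<le> dist (X m) (X n)" for m n
      using cmod_coord_le_norm[of "X m - X n" i] by (simp add: dist_norm minus_ell2.rep_eq)
    ultimately show "\<exists>N. \<forall>m\<ge>N. \<forall>n\<ge>N. dist (coord (X m) i) (coord (X n) i) < e"
      by (meson le_less_trans)
  qed
  then have "\<exists>c. (\<lambda>n. coord (X n) i) \<longlonglongrightarrow> c" for i
    using Cauchy_convergent[of "\<lambda>n. coord (X n) i"] by (simp add: convergent_def)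
  then obtain l where l: "\<And>i. (\<lambda>n. coord (X n) i) \<longlonglongrightarrow> l i"
    using choice[of "\<lambda>i c. (\<lambda>n. coord (X n) i) \<longlonglongrightarrow> c"] by blast
  have tail: "(\<Sum>i\<in>F. (cmod (coord (X m) i - l i))\<^sup>2) \<le> e\<^sup>2"
    if N: "\<And>m n. m \<ge> N \<Longrightarrow> n \<ge> N \<Longrightarrow> dist (X m) (X n) < e" and m: "m \<ge> N" and F: "finite F" for F m N e
  proof (rule tendsto_upperbound)
    show "(\<lambda>n. \<Sum>i\<in>F. (cmod (coord (X m) i - coord (X n) i))\<^sup>2)
            \<longlonglongrightarrow> (\<Sum>i\<in>F. (cmod (coord (X m) i - l i))\<^sup>2)"
      by (intro tendsto_intros l)
    show "\<forall>\<^sub>F n in sequentially. (\<Sum>i\<in>F. (cmod (coord (X m) i - coord (X n) i))\<^sup>2) \<le> e\<^sup>2"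
      using eventually_ge_at_top[of N]
    proof eventually_elim
      case (elim n)
      have "(\<Sum>i\<in>F. (cmod (coord (X m) i - coord (X n) i))\<^sup>2) \<le> (norm (X m - X n))\<^sup>2"
        using sum_coord_le_norm[OF F, of "X m - X n"] by (simp add: minus_ell2.rep_eq)
      also have "\<dots> \<le> e\<^sup>2"
        using N[OF m elim] by (intro power_mono) (auto simp: dist_norm)
      finally show ?case .
    qed
  qed simp
  have ss: "square_summable (\<lambda>i. coord (X m) i - l i)"
    if N: "\<And>m n. m \<ge> N \<Longrightarrow> n \<ge> N \<Longrightarrow> dist (X m) (X n) < e" and m: "m \<ge> N" for m N e
    unfolding square_summable_def
    by (rule nonneg_bdd_above_summable_on) (auto intro!: bdd_aboveI tail[OF N m])
  obtain N1 where N1: "\<And>m n. m \<ge> N1 \<Longrightarrow> n \<ge> N1 \<Longrightarrow> dist (X m) (X n) < 1"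
    using X by (meson metric_CauchyD zero_less_one)
  have "square_summable (\<lambda>i. coord (X N1) i + - 1 * (coord (X N1) i - l i))"
    by (intro square_summable_add square_summable_cmult ss[OF N1]) auto
  then have "square_summable l"
    by simp
  then have L: "coord (Abs_ell2 l) = l"
    by (simp add: Abs_ell2_inverse)
  have "X \<longlonglongrightarrow> Abs_ell2 l"
  proof (rule metric_LIMSEQ_I)
    fix e :: real
    assume e: "e > 0"
    then obtain N where N: "\<And>m n. m \<ge> N \<Longrightarrow> n \<ge> N \<Longrightarrow> dist (X m) (X n) < e / 2"
      using X by (meson half_gt_zero metric_CauchyD)
    have "dist (X m) (Abs_ell2 l) < e" if m: "m \<ge> N" for m
    proof -
      have "(norm (X m - Abs_ell2 l))\<^sup>2 \<le> (e / 2)\<^sup>2"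
        unfolding norm_ell2_sq minus_ell2.rep_eq L
        using ss[OF N m] by (intro infsum_le_finite_sums tail[OF N m]) (auto simp: square_summable_def)
      then have "norm (X m - Abs_ell2 l) \<le> e / 2"
        using e by (auto intro: power2_le_imp_le)
      then show ?thesis
        using e by (simp add: dist_norm)
    qed
    then show "\<exists>N. \<forall>m\<ge>N. dist (X m) (Abs_ell2 l) < e"
      by blast
  qed
  then show "convergent X"
    by (auto simp: convergent_def)
qed

section \<open>Adjoints and C*-algebra operations\<close>

lemma cstar_subalgebraD:
  assumes "cstar_subalgebra A"
  shows "A \<subseteq> bounded_ops" and "closed A" and "0 \<in> A"
    and "a \<in> A \<Longrightarrow> b \<in> A \<Longrightarrow> a + b \<in> A" and "a \<in> A \<Longrightarrow> b \<in> A \<Longrightarrow> a o\<^sub>L b \<in> A"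
    and "a \<in> A \<Longrightarrow> c *\<^sub>O a \<in> A" and "a \<in> A \<Longrightarrow> adj a \<in> A"
  using assms unfolding cstar_subalgebra_def by auto

lemma scaleR_eq_cscale_op: "r *\<^sub>R a = complex_of_real r *\<^sub>O (a :: 'a op)"
  by (rule blinfun_eqI) (simp add: cscale_op_apply blinfun.scaleR_left scaleR_eq_cscale)

lemma cstar_subalgebra_scaleR: "cstar_subalgebra A \<Longrightarrow> a \<in> A \<Longrightarrow> r *\<^sub>R a \<in> A"
  by (simp add: scaleR_eq_cscale_op cstar_subalgebraD)

lemma cstar_subalgebra_diff:
  assumes "cstar_subalgebra A" "a \<in> A" "b \<in> A"
  shows "a - b \<in> A"
  using cstar_subalgebraD(4)[OF assms(1,2) cstar_subalgebra_scaleR[OF assms(1,3), of "-1"]] by simp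

lemma cstar_subalgebra_sum:
  assumes "cstar_subalgebra A" "\<And>i. i \<in> I \<Longrightarrow> a i \<in> A"
  shows "(\<Sum>i\<in>I. a i) \<in> A"
  using assms(2) by (induction I rule: infinite_finite_induct) (auto intro: cstar_subalgebraD[OF assms(1)])

lemma cinner_diff_left: "cinner (x - y) z = cinner x z - cinner y z"
  using cinner_add_left[of "x - y" y z] by simp

lemma cinner_diff_right: "cinner x (y - z) = cinner x y - cinner x z"
  using cinner_add_right[of x "y - z" z] by simp

lemma adj_add: "a \<in> bounded_ops \<Longrightarrow> b \<in> bounded_ops \<Longrightarrow> adj (a + b) = adj a + adj b"
  by (rule adj_eqI) (simp add: blinfun.add_left cinner_add_left cinner_add_right cinner_adj)

lemma adj_diff: "a \<in> bounded_ops \<Longrightarrow> b \<in> bounded_ops \<Longrightarrow> adj (a - b) = adj a - adj b"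
  by (rule adj_eqI) (simp add: blinfun.diff_left cinner_diff_left cinner_diff_right cinner_adj)

lemma adj_compose: "a \<in> bounded_ops \<Longrightarrow> b \<in> bounded_ops \<Longrightarrow> adj (a o\<^sub>L b) = adj b o\<^sub>L adj a"
  by (rule adj_eqI) (simp add: cinner_adj)

lemma adj_cscale_op: "a \<in> bounded_ops \<Longrightarrow> adj (c *\<^sub>O a) = cnj c *\<^sub>O adj a"
  by (rule adj_eqI) (simp add: cscale_op_apply cinner_cscale_left cinner_cscale_right cinner_adj)

lemma adj_adj: "a \<in> bounded_ops \<Longrightarrow> adj (adj a) = a"
  by (rule adj_eqI) (metis cinner_adj cinner_commute)

lemma adj_id: "adj id_blinfun = id_blinfun"
  by (rule adj_eqI) simp

lemma adj_zero: "adj 0 = 0"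
  by (rule adj_eqI) (simp add: cinner_def zero_ell2.rep_eq)

lemma norm_adj_le:
  assumes "a \<in> bounded_ops"
  shows "norm (adj a) \<le> norm a"
proof (rule norm_blinfun_bound)
  fix y
  have "norm (adj a y) * norm (adj a y) = Re (cinner (a (adj a y)) y)"
    by (simp add: cinner_adj[OF assms] norm_eq_sqrt_inner inner_ell2_def[symmetric])
  also have "\<dots> \<le> norm (a (adj a y)) * norm y"
    by (metis inner_ell2_def norm_cauchy_schwarz)
  also have "\<dots> \<le> (norm a * norm (adj a y)) * norm y"
    by (intro mult_right_mono norm_blinfun) simp
  finally show "norm (adj a y) \<le> norm a * norm y"
    by (cases "adj a y = 0") (auto simp: mult_ac mult_le_cancel_left)
qed simp

section \<open>States are contractive\<close>

text \<open>Writing \<open>s = 1 - y\<close> with \<open>y\<close> self-adjoint, the equation \<open>s\<^sup>2 = 1 - h\<close> says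
  \<open>y = (h + y\<^sup>2) / 2\<close>. The right-hand side is a contraction of a ball of radius less than \<open>1\<close> of
  the algebra, and its fixed point is self-adjoint because it is unique.\<close>

lemma cstar_sqrt_one_minus:
  fixes A :: "'a op set"
  assumes A: "cstar_subalgebra A" and id: "id_blinfun \<in> A"
    and h: "h \<in> A" "adj h = h" "norm h < 1"
  obtains s where "s \<in> A" "adj s o\<^sub>L s = id_blinfun - h"
proof -
  note A' = cstar_subalgebraD[OF A]
  \<comment> \<open>The smaller root of \<open>\<rho> = (\<parallel>h\<parallel> + \<rho>\<^sup>2) / 2\<close>, so that \<open>f\<close> below preserves the ball of radius \<open>\<rho>\<close>;
    on that ball \<open>y \<mapsto> y\<^sup>2 / 2\<close> has Lipschitz constant \<open>\<rho>\<close>.\<close>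
  define \<rho> where "\<rho> = 1 - sqrt (1 - norm h)"
  have \<rho>: "0 \<le> \<rho>" "\<rho> < 1" and \<rho>_fix: "norm h + \<rho> * \<rho> = 2 * \<rho>"
    using h(3) by (auto simp: \<rho>_def algebra_simps)
  define f where "f y = (1/2) *\<^sub>R (h + (y o\<^sub>L y))" for y :: "'a op"
  have fA: "f y \<in> A" if "y \<in> A" for y
    unfolding f_def using that h(1) by (intro cstar_subalgebra_scaleR A A')
  have f_norm: "norm (f y) \<le> \<rho>" if "norm y \<le> \<rho>" for y
  proof -
    have "norm (h + (y o\<^sub>L y)) \<le> norm h + \<rho> * \<rho>"
      using norm_triangle_ineq[of h "y o\<^sub>L y"] norm_blinfun_compose[of y y]
        mult_mono[OF that that] \<rho>(1) by simp
    then show ?thesis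
      using \<rho>_fix by (simp add: f_def)
  qed
  have f_dist: "dist (f y) (f z) \<le> \<rho> * dist y z" if yz: "norm y \<le> \<rho>" "norm z \<le> \<rho>" for y z
  proof -
    have "f y - f z = (1/2) *\<^sub>R ((y o\<^sub>L (y - z)) + ((y - z) o\<^sub>L z))"
      by (rule blinfun_eqI) (simp add: f_def algebra_simps blinfun.diff_left blinfun.diff_right
          blinfun.add_left blinfun.scaleR_left)
    moreover have "norm ((y o\<^sub>L (y - z)) + ((y - z) o\<^sub>L z)) \<le> \<rho> * norm (y - z) + norm (y - z) * \<rho>"
      by (intro norm_triangle_le add_mono order_trans[OF norm_blinfun_compose] mult_mono yz) (auto simp: \<rho>)
    ultimately show ?thesis
      by (simp add: dist_norm)
  qed
  have "\<exists>!y\<in>A \<inter> cball 0 \<rho>. f y = y"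
  proof (rule Banach_fix)
    show "complete (A \<inter> cball 0 \<rho>)"
      by (simp add: complete_eq_closed A'(2) closed_Int)
    show "A \<inter> cball 0 \<rho> \<noteq> {}"
      using A'(3) \<rho>(1) by force
  qed (use \<rho> fA f_norm f_dist in \<open>auto\<close>)
  then obtain y where y_fix: "y \<in> A \<inter> cball 0 \<rho> \<and> f y = y"
    and y_unique: "\<forall>z. z \<in> A \<inter> cball 0 \<rho> \<and> f z = z \<longrightarrow> z = y"
    by (rule ex1E)
  have y: "y \<in> A" "norm y \<le> \<rho>" "f y = y"
    using y_fix by simp_all
  have unique: "z = y" if "z \<in> A" "norm z \<le> \<rho>" "f z = z" for z
    using y_unique that by (metis IntI mem_cball_0)
  have ops: "y \<in> bounded_ops" "h \<in> bounded_ops" "(id_blinfun :: 'a op) \<in> bounded_ops" "y o\<^sub>L y \<in> bounded_ops"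
    by (simp_all add: subsetD[OF A'(1)] A'(5) y(1) h(1) id)
  have "f (adj y) = adj (f y)"
    using ops cstar_subalgebraD(4)[OF cstar_subalgebra_bounded_ops ops(2,4)]
    by (simp add: f_def scaleR_eq_cscale_op adj_cscale_op adj_add adj_compose h(2))
  then have "adj y = y"
    using norm_adj_le[OF ops(1)] y by (intro unique A'(7)) auto
  then have s: "adj (id_blinfun - y) = id_blinfun - y"
    using ops by (simp add: adj_diff adj_id)
  have "h + (y o\<^sub>L y) = 2 *\<^sub>R f y"
    by (simp add: f_def)
  then have "h + (y o\<^sub>L y) = y + y"
    by (simp add: y(3) scaleR_2)
  then have "h v + y (y v) = y v + y v" for v
    by (metis blinfun.add_left blinfun_apply_blinfun_compose)
  then have eq: "h v = y v + y v - y (y v)" for v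
    by (metis add_diff_cancel_right')
  have "(id_blinfun - y) o\<^sub>L (id_blinfun - y) = id_blinfun - h"
    by (rule blinfun_eqI) (simp add: blinfun.diff_left blinfun.diff_right eq)
  then show ?thesis
    using s by (intro that[of "id_blinfun - y"] cstar_subalgebra_diff A id y) auto
qed

text \<open>For \<open>\<parallel>x\<parallel> < 1\<close> the element \<open>1 - x\<^sup>*x\<close> is of the form \<open>s\<^sup>*s\<close>, hence \<open>\<phi>(x\<^sup>*x) \<le> 1\<close>, and the
  inequality \<open>\<bar>\<phi>(x)\<bar>\<^sup>2 \<le> \<phi>(x\<^sup>*x)\<close> follows from positivity at \<open>x + c 1\<close>.\<close>

lemma state_le_norm:
  assumes A: "cstar_subalgebra A" and id: "id_blinfun \<in> A" and \<phi>: "state A \<phi>" and x: "x \<in> A"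
  shows "cmod (\<phi> x) \<le> norm x"
proof -
  note A' = cstar_subalgebraD[OF A]
  have add: "\<phi> (a + b) = \<phi> a + \<phi> b" and scale: "\<phi> (c *\<^sub>O a) = c * \<phi> a"
    and pos: "\<phi> (adj a o\<^sub>L a) \<in> \<real>\<^sub>\<ge>\<^sub>0" and one: "\<phi> id_blinfun = 1" if "a \<in> A" "b \<in> A" for a b c
    using \<phi> that by (auto simp: state_def)
  have unit_ball: "cmod (\<phi> x) \<le> 1" if x: "x \<in> A" "norm x < 1" for x
  proof -
    define h where "h = adj x o\<^sub>L x"
    have xb: "x \<in> bounded_ops" "adj x \<in> bounded_ops"
      using A'(1) A'(7) x(1) by auto
    have h: "h \<in> A"
      using x by (simp add: h_def A')
    have "norm h \<le> norm x * norm x"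
      unfolding h_def using norm_adj_le[OF xb(1)]
      by (intro order_trans[OF norm_blinfun_compose] mult_right_mono) auto
    also have "\<dots> < 1"
      using x(2) mult_strict_mono[of "norm x" 1 "norm x" 1] by simp
    finally obtain s where s: "s \<in> A" "adj s o\<^sub>L s = id_blinfun - h"
      using cstar_sqrt_one_minus[OF A id h] xb by (auto simp: h_def adj_compose adj_adj)
    have "\<phi> id_blinfun = \<phi> (id_blinfun - h) + \<phi> h"
      using add[of "id_blinfun - h" h] h id A by (simp add: cstar_subalgebra_diff)
    moreover have "\<phi> (id_blinfun - h) \<in> \<real>\<^sub>\<ge>\<^sub>0"
      using pos[OF s(1) s(1)] s(2) by simp
    ultimately have h1: "Re (\<phi> h) \<le> 1"
      using one[OF id id] by (auto simp: complex_nonneg_Reals_iff complex_eq_iff)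
    have expand: "\<phi> h + c * \<phi> (adj x) + cnj c * \<phi> x + c * cnj c \<in> \<real>\<^sub>\<ge>\<^sub>0" for c
    proof -
      define y where "y = x + c *\<^sub>O id_blinfun"
      have y: "y \<in> A"
        by (simp add: y_def A' x id)
      have "adj y = adj x + cnj c *\<^sub>O id_blinfun"
        unfolding y_def using xb A'(1) A'(6) id
        by (subst adj_add) (auto simp: adj_cscale_op adj_id)
      moreover have "cscale c (cscale d v) = cscale (c * d) v" for c d and v :: "'a ell2"
        by transfer (simp add: mult.assoc)
      ultimately have "adj y o\<^sub>L y = h + c *\<^sub>O adj x + cnj c *\<^sub>O x + (c * cnj c) *\<^sub>O id_blinfun"
        using xb unfolding h_def y_def
        by (intro blinfun_eqI) (simp add: blinfun.add_left blinfun.add_right cscale_op_apply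
            bounded_ops_def mult.commute)
      then show ?thesis
        using pos[OF y y] h x id by (simp add: add scale one A')
    qed
    have "\<phi> h \<in> \<real>\<^sub>\<ge>\<^sub>0"
      using expand[of 0] by simp
    then have "Im (\<phi> h) = 0"
      by (simp add: complex_nonneg_Reals_iff)
    \<comment> \<open>The values at \<open>c = 1\<close> and \<open>c = \<i>\<close> are real, which determines \<open>\<phi>(x\<^sup>*)\<close>; then
      \<open>c = - \<phi>(x)\<close> is the minimizing choice.\<close>
    then have "\<phi> (adj x) = cnj (\<phi> x)"
      using expand[of 1] expand[of \<i>] by (simp add: complex_nonneg_Reals_iff complex_eq_iff)
    then have "\<phi> h - complex_of_real ((cmod (\<phi> x))\<^sup>2) \<in> \<real>\<^sub>\<ge>\<^sub>0"
      using expand[of "- \<phi> x"] by (simp add: complex_norm_square del: of_real_power)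
    then have "(cmod (\<phi> x))\<^sup>2 \<le> 1"
      using h1 by (simp add: complex_nonneg_Reals_iff del: of_real_power)
    then show ?thesis
      by (simp add: power_le_one_iff)
  qed
  show ?thesis
  proof (rule dense_ge)
    fix t
    assume t: "norm x < t"
    then have t0: "t > 0"
      using norm_ge_zero[of x] by linarith
    have "cmod (\<phi> ((1/t) *\<^sub>R x)) \<le> 1"
      using t t0 by (intro unit_ball cstar_subalgebra_scaleR A x) (simp add: field_simps)
    moreover have "\<phi> ((1/t) *\<^sub>R x) = (1/t) * \<phi> x"
      by (simp only: scaleR_eq_cscale_op scale[OF x x])
    ultimately show "cmod (\<phi> x) \<le> t"
      using t0 by (simp add: norm_mult norm_divide field_simps)
  qed
qed

section \<open>Density of the group ring\<close>

text \<open>The image of the complex group ring under the left regular representation, that is, the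
  complex span of the operators \<open>\<lambda>\<^sub>g\<close>. Adding one term at a time gives the induction
  principle in which the closure properties are proved.\<close>

inductive_set group_ring_ops :: "'g::group_add op set" where
  zero: "0 \<in> group_ring_ops"
| add: "a \<in> group_ring_ops \<Longrightarrow> c *\<^sub>O lreg g + a \<in> group_ring_ops"

lemma cinner_lreg: "cinner (lreg g x) (lreg g y) = cinner x y"
  by (rule reindex(2)[OF bij_left_translation[of "- g"]]) (simp add: coord_lreg)

lemma norm_lreg: "norm (lreg g x) = norm x"
  by (simp add: norm_eq_sqrt_inner inner_ell2_def cinner_lreg)

lemma adj_lreg: "adj (lreg g) = lreg (- g)"
proof (rule adj_eqI)
  fix x y
  have "cinner (lreg g x) y = cinner (lreg g x) (lreg g (lreg (- g) y))"
    by (simp add: lreg_zero flip: blinfun_apply_blinfun_compose lreg_add)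
  then show "cinner (lreg g x) y = cinner x (lreg (- g) y)"
    by (simp add: cinner_lreg)
qed

lemma lreg_in_reduced_group_cstar: "lreg g \<in> reduced_group_cstar"
  unfolding reduced_group_cstar_def by (rule hull_inc) simp

lemma cscale_op_add: "c *\<^sub>O (a + b) = c *\<^sub>O a + c *\<^sub>O b"
  by (simp add: cscale_op_def bounded_bilinear.add_right[OF bounded_bilinear_blinfun_compose])

lemma cscale_op_cscale_op: "c *\<^sub>O d *\<^sub>O a = (c * d) *\<^sub>O a"
proof -
  have "cscale c (cscale d v) = cscale (c * d) v" for v :: "'a ell2"
    by transfer (simp add: mult.assoc)
  then show ?thesis
    by (intro blinfun_eqI) (simp add: cscale_op_apply)
qed

lemma cscale_op_zero: "c *\<^sub>O 0 = 0"
  by (simp add: cscale_op_def)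

lemma cscale_op_one: "1 *\<^sub>O a = a"
proof -
  have "cscale 1 v = v" for v :: "'a ell2"
    by transfer simp
  then show ?thesis
    by (intro blinfun_eqI) (simp add: cscale_op_apply)
qed

lemma group_ring_ops_subset:
  assumes "cstar_subalgebra A" "range lreg \<subseteq> A"
  shows "group_ring_ops \<subseteq> A"
proof
  fix a :: "'a op"
  assume "a \<in> group_ring_ops"
  then show "a \<in> A"
    using assms(2) by induction (auto simp: cstar_subalgebraD(3,4,6)[OF assms(1)] image_subset_iff)
qed

lemma group_ring_ops_cstar_closed:
  assumes a: "a \<in> group_ring_ops"
  shows "b \<in> group_ring_ops \<Longrightarrow> a + b \<in> group_ring_ops"
    and "c *\<^sub>O a \<in> group_ring_ops"
    and "b \<in> group_ring_ops \<Longrightarrow> a o\<^sub>L b \<in> group_ring_ops"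
    and "adj a \<in> group_ring_ops"
proof -
  have plus: "a + b \<in> group_ring_ops" if "a \<in> group_ring_ops" "b \<in> group_ring_ops" for a b :: "'a op"
    using that by (induction a rule: group_ring_ops.induct) (simp_all add: group_ring_ops.add add.assoc)
  have scale: "c *\<^sub>O a \<in> group_ring_ops" if "a \<in> group_ring_ops" for c and a :: "'a op"
    using that by (induction a rule: group_ring_ops.induct)
      (simp_all add: group_ring_ops.zero group_ring_ops.add cscale_op_add cscale_op_cscale_op cscale_op_zero)
  have lreg_mult: "lreg g o\<^sub>L b \<in> group_ring_ops" if "b \<in> group_ring_ops" for g and b :: "'a op"
    using that
  proof (induction b rule: group_ring_ops.induct)
    case (add a c h)
    have "lreg g o\<^sub>L (c *\<^sub>O lreg h + a) = c *\<^sub>O lreg (g + h) + (lreg g o\<^sub>L a)"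
      using lreg_in_bounded_ops[of g]
      by (intro blinfun_eqI) (simp add: blinfun.add_left blinfun.add_right cscale_op_apply lreg_add bounded_ops_def)
    with add show ?case
      by (simp add: group_ring_ops.add)
  qed (simp add: group_ring_ops.zero)
  have mult: "a o\<^sub>L b \<in> group_ring_ops" if "a \<in> group_ring_ops" "b \<in> group_ring_ops" for a b :: "'a op"
    using that(1)
  proof (induction a rule: group_ring_ops.induct)
    case (add a c g)
    have "(c *\<^sub>O lreg g + a) o\<^sub>L b = c *\<^sub>O (lreg g o\<^sub>L b) + (a o\<^sub>L b)"
      by (intro blinfun_eqI) (simp add: blinfun.add_left cscale_op_apply)
    with add \<open>b \<in> group_ring_ops\<close> show ?case
      by (simp add: plus scale lreg_mult)
  qed (simp add: group_ring_ops.zero)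
  have adj: "adj a \<in> group_ring_ops" if "a \<in> group_ring_ops" for a :: "'a op"
    using that
  proof (induction a rule: group_ring_ops.induct)
    case (add a c g)
    have "a \<in> bounded_ops" "c *\<^sub>O lreg g \<in> bounded_ops"
      using add(1) group_ring_ops_subset[OF cstar_subalgebra_bounded_ops] lreg_in_bounded_ops
        cstar_subalgebraD(6)[OF cstar_subalgebra_bounded_ops] by blast+
    with add show ?case
      by (simp add: adj_add adj_cscale_op lreg_in_bounded_ops adj_lreg group_ring_ops.add)
  qed (simp add: adj_zero group_ring_ops.zero)
  show "b \<in> group_ring_ops \<Longrightarrow> a + b \<in> group_ring_ops" "c *\<^sub>O a \<in> group_ring_ops"
    "b \<in> group_ring_ops \<Longrightarrow> a o\<^sub>L b \<in> group_ring_ops" "adj a \<in> group_ring_ops"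
    by (simp_all add: a plus scale mult adj)
qed

lemma lreg_in_group_ring_ops: "lreg g \<in> group_ring_ops"
  using group_ring_ops.add[OF group_ring_ops.zero, of 1 g] by (simp add: cscale_op_one)

text \<open>The group ring is a *-algebra, and all operations of a C*-algebra are norm continuous, so
  its closure is a C*-algebra that contains the generators \<open>\<lambda>\<^sub>g\<close>.\<close>

lemma reduced_group_cstar_subset_closure: "reduced_group_cstar \<subseteq> closure group_ring_ops"
  unfolding reduced_group_cstar_def
proof (rule hull_minimal)
  show "range lreg \<subseteq> closure (group_ring_ops :: 'a op set)"
    using closure_subset lreg_in_group_ring_ops by blast
  have sub: "group_ring_ops \<subseteq> (bounded_ops :: 'a op set)"
    by (rule group_ring_ops_subset[OF cstar_subalgebra_bounded_ops]) (auto simp: lreg_in_bounded_ops)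
  show "cstar_subalgebra (closure group_ring_ops :: 'a op set)"
    unfolding cstar_subalgebra_def
  proof (intro conjI ballI allI)
    show "closure group_ring_ops \<subseteq> (bounded_ops :: 'a op set)"
      by (rule closure_minimal[OF sub cstar_subalgebraD(2)[OF cstar_subalgebra_bounded_ops]])
    show "(0 :: 'a op) \<in> closure group_ring_ops"
      using closure_subset group_ring_ops.zero by blast
    fix a :: "'a op"
    assume "a \<in> closure group_ring_ops"
    then obtain x where x: "\<And>n. x n \<in> group_ring_ops" "x \<longlonglongrightarrow> a"
      by (auto simp: closure_sequential)
    have ab: "a \<in> bounded_ops" "x n \<in> bounded_ops" for n
      using \<open>closure group_ring_ops \<subseteq> bounded_ops\<close> \<open>a \<in> closure group_ring_ops\<close> x(1) sub by blast+
    show "c *\<^sub>O a \<in> closure group_ring_ops" for c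
    proof -
      have "(\<lambda>n. c *\<^sub>O x n) \<longlonglongrightarrow> c *\<^sub>O a"
        unfolding cscale_op_def
        by (intro bounded_bilinear.tendsto[OF bounded_bilinear_blinfun_compose] tendsto_const x)
      then show ?thesis
        using group_ring_ops_cstar_closed(2)[OF x(1)] unfolding closure_sequential
        by (intro exI[of _ "\<lambda>n. c *\<^sub>O x n"]) simp
    qed
    show "adj a \<in> closure group_ring_ops"
    proof -
      have "(\<lambda>n. norm (x n - a)) \<longlonglongrightarrow> 0"
        using x(2) by (simp add: LIM_zero tendsto_norm_zero)
      moreover have "norm (adj (x n) - adj a) \<le> norm (x n - a)" for n
        using norm_adj_le[OF cstar_subalgebra_diff[OF cstar_subalgebra_bounded_ops ab(2,1)]]
        by (simp add: adj_diff ab)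
      ultimately have "(\<lambda>n. adj (x n) - adj a) \<longlonglongrightarrow> 0"
        by (intro Lim_null_comparison[of "\<lambda>n. adj (x n) - adj a" "\<lambda>n. norm (x n - a)"]) auto
      then have "(\<lambda>n. adj (x n)) \<longlonglongrightarrow> adj a"
        by (simp add: LIM_zero_iff)
      then show ?thesis
        using group_ring_ops_cstar_closed(4)[OF x(1)] unfolding closure_sequential
        by (intro exI[of _ "\<lambda>n. adj (x n)"]) simp
    qed
    fix b :: "'a op"
    assume "b \<in> closure group_ring_ops"
    then obtain y where y: "\<And>n. y n \<in> group_ring_ops" "y \<longlonglongrightarrow> b"
      by (auto simp: closure_sequential)
    show "a + b \<in> closure group_ring_ops"
      using tendsto_add[OF x(2) y(2)] group_ring_ops_cstar_closed(1)[OF x(1) y(1)]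
      unfolding closure_sequential by (intro exI[of _ "\<lambda>n. x n + y n"]) simp
    show "a o\<^sub>L b \<in> closure group_ring_ops"
      using bounded_bilinear.tendsto[OF bounded_bilinear_blinfun_compose x(2) y(2)]
        group_ring_ops_cstar_closed(3)[OF x(1) y(1)]
      unfolding closure_sequential by (intro exI[of _ "\<lambda>n. x n o\<^sub>L y n"]) simp
  qed (rule closed_closure)
qed

section \<open>A ping-pong norm estimate\<close>

lift_definition restrict_to :: "'a set \<Rightarrow> 'a ell2 \<Rightarrow> 'a ell2" is "\<lambda>S x i. if i \<in> S then x i else 0"
  unfolding square_summable_def by (erule summable_on_comparison_test) auto

lemma cinner_disjoint_supports:
  assumes "\<And>i. coord x i = 0 \<or> coord y i = 0"
  shows "cinner x y = 0"
  unfolding cinner_def by (rule infsum_0) (use assms in auto)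

lemma norm_restrict_to:
  "(norm x)\<^sup>2 = (norm (restrict_to S x))\<^sup>2 + (norm (restrict_to (- S) x))\<^sup>2"
proof -
  have "x = restrict_to S x + restrict_to (- S) x"
    by (rule ell2_eqI) (simp add: plus_ell2.rep_eq restrict_to.rep_eq)
  moreover have "orthogonal (restrict_to S x) (restrict_to (- S) x)"
    by (simp add: orthogonal_def inner_ell2_def cinner_disjoint_supports restrict_to.rep_eq)
  ultimately show ?thesis
    using norm_add_Pythagorean by metis
qed

text \<open>Bessel's inequality for the projections onto families supported in disjoint sets: the
  restrictions are pairwise orthogonal, and they add up to the restriction to the union.\<close>

lemma sum_norm_restrict_to_le:
  assumes K: "finite K" and disj: "disjoint_family_on B K"
  shows "(\<Sum>k\<in>K. (norm (restrict_to (B k) x))\<^sup>2) \<le> (norm x)\<^sup>2"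
proof -
  have "(\<Sum>k\<in>K. (norm (restrict_to (B k) x))\<^sup>2) = (norm (\<Sum>k\<in>K. restrict_to (B k) x))\<^sup>2"
  proof (rule norm_sum_Pythagorean[OF K, symmetric], rule pairwiseI)
    fix k l
    assume "k \<in> K" "l \<in> K" "k \<noteq> l"
    then have "B k \<inter> B l = {}"
      using disj by (auto simp: disjoint_family_on_def)
    then have "cinner (restrict_to (B k) x) (restrict_to (B l) x) = 0"
      by (intro cinner_disjoint_supports) (auto simp: restrict_to.rep_eq)
    then show "orthogonal (restrict_to (B k) x) (restrict_to (B l) x)"
      by (simp add: orthogonal_def inner_ell2_def)
  qed
  also have "(\<Sum>k\<in>K. restrict_to (B k) x) = restrict_to (\<Union>k\<in>K. B k) x"
  proof (rule ell2_eqI)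
    fix i
    show "coord (\<Sum>k\<in>K. restrict_to (B k) x) i = coord (restrict_to (\<Union>k\<in>K. B k) x) i"
    proof (cases "\<exists>k\<in>K. i \<in> B k")
      case True
      then obtain l where l: "l \<in> K" "i \<in> B l" by blast
      then have "i \<in> B k \<longleftrightarrow> k = l" if "k \<in> K" for k
        using disj that by (auto simp: disjoint_family_on_def)
      then have "coord (\<Sum>k\<in>K. restrict_to (B k) x) i = (\<Sum>k\<in>K. if k = l then coord x i else 0)"
        unfolding coord_sum restrict_to.rep_eq by (intro sum.cong) auto
      then show ?thesis
        using K l by (auto simp: restrict_to.rep_eq)
    next
      case False
      then have "coord (\<Sum>k\<in>K. restrict_to (B k) x) i = (\<Sum>k\<in>K. 0)"
        unfolding coord_sum restrict_to.rep_eq by (intro sum.cong) auto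
      with False show ?thesis
        by (auto simp: restrict_to.rep_eq)
    qed
  qed
  also have "(norm \<dots>)\<^sup>2 \<le> (norm x)\<^sup>2"
    by (simp add: norm_restrict_to[of x "\<Union>k\<in>K. B k"])
  finally show ?thesis .
qed

text \<open>Split a vector \<open>x\<close> separately for each \<open>k\<close> into its parts off and on \<open>B k\<close>. The translate by
  \<open>h k\<close> of the part off \<open>B k\<close> is supported in \<open>C k\<close>, so these translates are orthogonal and
  Pythagoras applies. The parts on \<open>B k\<close> have square norms with sum at most \<open>\<parallel>x\<parallel>\<^sup>2\<close>, so the
  triangle inequality and Cauchy--Schwarz suffice for their translates. Each half contributes
  one \<open>\<ell>\<^sup>2\<close>-norm of the coefficients.\<close>

lemma norm_sum_lreg_ping_pong:
  fixes h :: "'k \<Rightarrow> 'g::group_add"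
  assumes K: "finite K" and B: "disjoint_family_on B K" and C: "disjoint_family_on C K"
    and move: "\<And>k v. k \<in> K \<Longrightarrow> v \<notin> B k \<Longrightarrow> h k + v \<in> C k"
  shows "norm (\<Sum>k\<in>K. c k *\<^sub>O lreg (h k)) \<le> 2 * sqrt (\<Sum>k\<in>K. (cmod (c k))\<^sup>2)"
proof (rule norm_blinfun_bound)
  fix x :: "'g ell2"
  let ?s = "\<Sum>k\<in>K. (cmod (c k))\<^sup>2"
  define u where "u k = cscale (c k) (lreg (h k) (restrict_to (- B k) x))" for k
  define w where "w k = cscale (c k) (lreg (h k) (restrict_to (B k) x))" for k
  have split: "(c k *\<^sub>O lreg (h k)) x = u k + w k" for k
    by (rule ell2_eqI) (simp add: u_def w_def cscale_op_apply cscale.rep_eq coord_lreg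
        plus_ell2.rep_eq restrict_to.rep_eq)
  have u_norm: "(norm (u k))\<^sup>2 \<le> (cmod (c k))\<^sup>2 * (norm x)\<^sup>2" for k
    by (simp add: u_def norm_cscale norm_lreg power_mult_distrib norm_restrict_to[of x "B k"]
        mult_left_mono)
  have supp: "coord (u k) i = 0" if "k \<in> K" "i \<notin> C k" for k i
  proof -
    have "- h k + i \<in> B k"
      using move[OF that(1), of "- h k + i"] that(2) by (auto simp flip: add.assoc)
    then show ?thesis
      by (simp add: u_def cscale.rep_eq coord_lreg restrict_to.rep_eq)
  qed
  have "(norm (\<Sum>k\<in>K. u k))\<^sup>2 = (\<Sum>k\<in>K. (norm (u k))\<^sup>2)"
  proof (rule norm_sum_Pythagorean[OF K], rule pairwiseI)
    fix k l
    assume kl: "k \<in> K" "l \<in> K" "k \<noteq> l"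
    then have "cinner (u k) (u l) = 0"
      using C by (intro cinner_disjoint_supports) (meson supp disjoint_iff disjoint_family_on_def)
    then show "orthogonal (u k) (u l)"
      by (simp add: orthogonal_def inner_ell2_def)
  qed
  also have "\<dots> \<le> ?s * (norm x)\<^sup>2"
    unfolding sum_distrib_right by (intro sum_mono u_norm)
  also have "\<dots> = (sqrt ?s * norm x)\<^sup>2"
    by (simp add: power_mult_distrib sum_nonneg)
  finally have U: "norm (\<Sum>k\<in>K. u k) \<le> sqrt ?s * norm x"
    by (rule power2_le_imp_le) (simp add: sum_nonneg)
  have "norm (\<Sum>k\<in>K. w k) \<le> (\<Sum>k\<in>K. \<bar>cmod (c k)\<bar> * \<bar>norm (restrict_to (B k) x)\<bar>)"
    by (rule order_trans[OF norm_sum]) (simp add: w_def norm_cscale norm_lreg)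
  also have "\<dots> \<le> sqrt ?s * sqrt (\<Sum>k\<in>K. (norm (restrict_to (B k) x))\<^sup>2)"
    using L2_set_mult_ineq[of "\<lambda>k. cmod (c k)" "\<lambda>k. norm (restrict_to (B k) x)" K]
    by (simp add: L2_set_def)
  also have "\<dots> \<le> sqrt ?s * norm x"
    using sum_norm_restrict_to_le[OF K B, of x]
    by (intro mult_left_mono real_le_lsqrt) (auto simp: sum_nonneg)
  finally have W: "norm (\<Sum>k\<in>K. w k) \<le> sqrt ?s * norm x" .
  have "(\<Sum>k\<in>K. c k *\<^sub>O lreg (h k)) x = (\<Sum>k\<in>K. u k) + (\<Sum>k\<in>K. w k)"
    by (simp add: blinfun.sum_left split sum.distrib)
  then show "norm ((\<Sum>k\<in>K. c k *\<^sub>O lreg (h k)) x) \<le> 2 * sqrt ?s * norm x"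
    using norm_triangle_ineq[of "\<Sum>k\<in>K. u k" "\<Sum>k\<in>K. w k"] U W by simp
qed (simp add: sum_nonneg)

section \<open>Translates of a group element under the free shift\<close>

definition shift_letter :: "int \<times> bool \<Rightarrow> int \<times> bool" where
  "shift_letter a = (fst a + 1, snd a)"

lemma reduced_append_foldr_push: "reduced (u @ v) \<Longrightarrow> foldr push u v = u @ v"
  by (induction u) (auto simp: reduced_Cons push_def split: list.splits)

lemma reduced_word_of: "reduced (word_of g)"
  using word_of[of g] by simp

lemma reduced_append_iff:
  "reduced (u @ v) \<longleftrightarrow>
     reduced u \<and> reduced v \<and> (u = [] \<or> v = [] \<or> hd v \<noteq> inv_letter (last u))"
  by (auto simp: reduced_def successively_append_iff)

text \<open>Shifting the indices creates no cancellation, so the reduced word of the image is obtained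
  letter by letter.\<close>

lemma word_of_free_shift: "word_of (free_shift g) = map shift_letter (word_of g)"
proof -
  have "reduced w \<Longrightarrow>
      word_of (sum_list (map (eval_letter (\<lambda>i. gen (i + 1))) w)) = map shift_letter w" for w
  proof (induction w)
    case (Cons a w)
    have "word_of (eval_letter (\<lambda>i. gen (i + 1)) a) = [shift_letter a]"
      by (cases a) (auto simp: eval_letter_def gen.rep_eq uminus_free_group.rep_eq
          shift_letter_def inv_letter_def)
    with Cons show ?case
      by (cases w) (auto simp: plus_free_group.rep_eq reduced_Cons push_def shift_letter_def
          inv_letter_def prod_eq_iff)
  qed (simp add: zero_free_group.rep_eq)
  then show ?thesis
    by (simp add: free_shift_def free_group_lift_def reduced_word_of)
qed

lemma funpow_shift_letter: "(shift_letter ^^ k) a = (fst a + int k, snd a)"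
  by (induction k) (auto simp: shift_letter_def)

lemma word_of_funpow_free_shift:
  "word_of ((free_shift ^^ k) g) = map (shift_letter ^^ k) (word_of g)"
  by (induction k) (simp_all add: word_of_free_shift)

text \<open>The two families of sets in the ping-pong consist of words with a prescribed first letter.
  The prescribed letters have indices that grow with \<open>k\<close>, hence are distinct, whether or not the
  words of the elements \<open>\<beta>\<^sup>k g\<close> share other letters.\<close>

lemma norm_sum_lreg_shifts:
  assumes g: "g \<noteq> 0"
  shows "norm (\<Sum>k<n. c k *\<^sub>O lreg ((free_shift ^^ k) g)) \<le> 2 * sqrt (\<Sum>k<n. (cmod (c k))\<^sup>2)"
proof -
  define u where "u = word_of g"
  have u: "u \<noteq> []"
    using g by (metis u_def word_of_inject zero_free_group.rep_eq)
  define starts where "starts a = {v. word_of v \<noteq> [] \<and> hd (word_of v) = a}" for a :: "int \<times> bool"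
  \<comment> \<open>Cancellation in \<open>\<beta>\<^sup>k g + v\<close> can only start if the word of \<open>v\<close> begins with the inverse of the
    last letter of \<open>\<beta>\<^sup>k g\<close>; otherwise the first letter of \<open>\<beta>\<^sup>k g\<close> survives.\<close>
  define B where "B k = starts (inv_letter ((shift_letter ^^ k) (last u)))" for k
  define C where "C k = starts ((shift_letter ^^ k) (hd u))" for k
  have "disjoint_family_on B {..<n}" "disjoint_family_on C {..<n}"
    by (auto simp: disjoint_family_on_def B_def C_def starts_def funpow_shift_letter inv_letter_def)
  moreover have "(free_shift ^^ k) g + v \<in> C k" if "v \<notin> B k" for k v
  proof -
    let ?u = "map (shift_letter ^^ k) u"
    have "reduced ?u"
      using reduced_word_of[of "(free_shift ^^ k) g"] by (simp add: word_of_funpow_free_shift u_def)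
    then have "reduced (?u @ word_of v)"
      using that u by (auto simp: reduced_append_iff reduced_word_of B_def starts_def last_map)
    then have "word_of ((free_shift ^^ k) g + v) = ?u @ word_of v"
      by (simp add: plus_free_group.rep_eq word_of_funpow_free_shift reduced_append_foldr_push flip: u_def)
    then show ?thesis
      using u by (simp add: C_def starts_def hd_map)
  qed
  ultimately show ?thesis
    by (intro norm_sum_lreg_ping_pong[where B = B and C = C]) auto
qed

section \<open>Cesaro means of states along the free shift\<close>

text \<open>Applying the automorphism to the entries of \<open>B\<close> turns \<open>B\<^sup>*B\<close> into another matrix of that
  form.\<close>

lemma star_automorphism_completely_positive:
  assumes A: "cstar_subalgebra A" and \<alpha>: "star_automorphism A \<alpha>"
  shows "completely_positive A \<alpha>"
  unfolding completely_positive_def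
proof (intro conjI allI impI)
  show lin: "alg_linear A \<alpha>"
    using \<alpha> by (simp add: star_automorphism_def)
  have \<alpha>_in: "\<alpha> a \<in> A" and \<alpha>_add: "\<alpha> (a + b) = \<alpha> a + \<alpha> b"
    and \<alpha>_mult: "\<alpha> (a o\<^sub>L b) = \<alpha> a o\<^sub>L \<alpha> b" if "a \<in> A" "b \<in> A" for a b
    using \<alpha> that by (auto simp: star_automorphism_def alg_linear_def)
  have \<alpha>_adj: "\<alpha> (adj a) = adj (\<alpha> a)" if "a \<in> A" for a
    using \<alpha> that by (simp add: star_automorphism_def)
  have "\<alpha> 0 = 0"
    using \<alpha>_add[of 0 0] cstar_subalgebraD(3)[OF A] by simp
  then have \<alpha>_sum: "\<alpha> (\<Sum>k\<in>K. a k) = (\<Sum>k\<in>K. \<alpha> (a k))" if "\<And>k. k \<in> K \<Longrightarrow> a k \<in> A"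
    for K :: "nat set" and a
    using that by (induction K rule: infinite_finite_induct) (simp_all add: \<alpha>_add cstar_subalgebra_sum A)
  fix n X
  assume "positive_matrix A n X"
  then obtain B where B: "\<And>i j. i < n \<Longrightarrow> j < n \<Longrightarrow> B i j \<in> A"
    and X: "\<And>i j. i < n \<Longrightarrow> j < n \<Longrightarrow> X i j = (\<Sum>k<n. adj (B k i) o\<^sub>L B k j)"
    unfolding positive_matrix_def by blast
  have "\<alpha> (X i j) = (\<Sum>k<n. adj (\<alpha> (B k i)) o\<^sub>L \<alpha> (B k j))" if "i < n" "j < n" for i j
  proof -
    have "\<alpha> (X i j) = (\<Sum>k<n. \<alpha> (adj (B k i) o\<^sub>L B k j))"
      unfolding X[OF that] using that by (intro \<alpha>_sum cstar_subalgebraD(5,7)[OF A] B) auto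
    also have "\<dots> = (\<Sum>k<n. adj (\<alpha> (B k i)) o\<^sub>L \<alpha> (B k j))"
      using that by (intro sum.cong refl) (simp add: \<alpha>_mult \<alpha>_adj B cstar_subalgebraD(7)[OF A])
    finally show ?thesis .
  qed
  then show "positive_matrix A n (\<lambda>i j. \<alpha> (X i j))"
    unfolding positive_matrix_def using B \<alpha>_in by (intro exI[of _ "\<lambda>i j. \<alpha> (B i j)"]) blast
qed

text \<open>This replaces norm estimates for the powers of \<open>\<alpha>\<close>: since all \<open>\<phi> \<circ> \<alpha>\<^sup>k\<close> are states, they
  are contractive uniformly in \<open>k\<close>.\<close>

lemma state_comp_funpow:
  assumes "cstar_subalgebra A" "star_automorphism A \<alpha>" "\<alpha> id_blinfun = id_blinfun" "state A \<phi>"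
  shows "state A (\<lambda>x. \<phi> ((\<alpha> ^^ k) x))"
proof (induction k)
  case (Suc k)
  have step: "state A (\<lambda>x. \<psi> (\<alpha> x))" if \<psi>: "state A \<psi>" for \<psi>
    unfolding state_def
  proof (intro conjI ballI allI)
    fix a b c
    assume a: "a \<in> A"
    have \<alpha>: "\<alpha> a \<in> A" "\<alpha> (adj a o\<^sub>L a) = adj (\<alpha> a) o\<^sub>L \<alpha> a" "\<alpha> (c *\<^sub>O a) = c *\<^sub>O \<alpha> a"
      using assms(2) a cstar_subalgebraD(7)[OF assms(1) a] by (simp_all add: star_automorphism_def alg_linear_def)
    then show "\<psi> (\<alpha> (c *\<^sub>O a)) = c * \<psi> (\<alpha> a)" "\<psi> (\<alpha> (adj a o\<^sub>L a)) \<in> \<real>\<^sub>\<ge>\<^sub>0"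
      using \<psi> by (simp_all add: state_def)
    assume b: "b \<in> A"
    have "\<alpha> b \<in> A" "\<alpha> (a + b) = \<alpha> a + \<alpha> b"
      using assms(2) a b by (simp_all add: star_automorphism_def alg_linear_def)
    then show "\<psi> (\<alpha> (a + b)) = \<psi> (\<alpha> a) + \<psi> (\<alpha> b)"
      using \<psi> \<alpha>(1) by (simp add: state_def)
  qed (use \<psi> assms(3) in \<open>simp add: state_def\<close>)
  show ?case
    using step[OF Suc] by (simp add: funpow_Suc_right del: funpow.simps)
qed (use assms in simp)

text \<open>The Cesaro means of absolute values are subadditive in \<open>x\<close> and bounded by \<open>K \<parallel>x\<parallel>\<close>
  independently of \<open>n\<close>, so those \<open>x\<close> for which they tend to \<open>0\<close> form a closed subspace.\<close>

lemma cesaro_null_of_generators: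
  fixes \<psi> :: "nat \<Rightarrow> 'g::group_add op \<Rightarrow> complex"
  assumes add: "\<And>k x y. x \<in> reduced_group_cstar \<Longrightarrow> y \<in> reduced_group_cstar \<Longrightarrow> \<psi> k (x + y) = \<psi> k x + \<psi> k y"
    and scale: "\<And>k c x. x \<in> reduced_group_cstar \<Longrightarrow> \<psi> k (c *\<^sub>O x) = c * \<psi> k x"
    and bound: "\<And>k x. x \<in> reduced_group_cstar \<Longrightarrow> cmod (\<psi> k x) \<le> K * norm x"
    and gen: "\<And>g. (\<lambda>n. (\<Sum>k<n. cmod (\<psi> k (lreg g))) / real n) \<longlonglongrightarrow> 0"
    and x: "x \<in> reduced_group_cstar"
  shows "(\<lambda>n. (\<Sum>k<n. cmod (\<psi> k x)) / real n) \<longlonglongrightarrow> 0"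
proof -
  let ?A = "reduced_group_cstar :: 'g op set"
  note A = cstar_subalgebra_reduced_group_cstar
  define M where "M x n = (\<Sum>k<n. cmod (\<psi> k x)) / real n" for x n
  have M_nonneg: "0 \<le> M x n" for x n
    by (simp add: M_def sum_nonneg)
  have M_add: "M (x + y) n \<le> M x n + M y n" if "x \<in> ?A" "y \<in> ?A" for x y n
    unfolding M_def add_divide_distrib[symmetric] sum.distrib[symmetric]
    by (intro divide_right_mono sum_mono) (simp_all add: add[OF that] norm_triangle_ineq)
  have M_scale: "M (c *\<^sub>O x) n = cmod c * M x n" if "x \<in> ?A" for c x n
    by (simp add: M_def scale[OF that] norm_mult sum_distrib_left)
  have M_bound: "M x n \<le> K * norm x" if "x \<in> ?A" for x n
  proof (cases "n = 0")
    case True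
    have "0 \<le> K * norm x"
      using bound[OF that, of 0] norm_ge_zero order_trans by blast
    with True show ?thesis
      by (simp add: M_def)
  next
    case False
    have "(\<Sum>k<n. cmod (\<psi> k x)) \<le> (\<Sum>k<n. K * norm x)"
      by (intro sum_mono bound that)
    with False show ?thesis
      by (simp add: M_def divide_le_eq mult.commute)
  qed
  have ring_sub: "group_ring_ops \<subseteq> ?A"
    by (rule group_ring_ops_subset[OF A]) (auto simp: lreg_in_reduced_group_cstar)
  have ring: "M y \<longlonglongrightarrow> 0" if "y \<in> group_ring_ops" for y
    using that
  proof (induction y rule: group_ring_ops.induct)
    case zero
    have "M 0 n = 0" for n
      using M_bound[OF cstar_subalgebraD(3)[OF A], of n] M_nonneg[of 0 n] by simp
    then show ?case
      by (simp add: tendsto_const fun_eq_iff[symmetric])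
  next
    case (add a c g)
    have le: "M (c *\<^sub>O lreg g + a) n \<le> cmod c * M (lreg g) n + M a n" for n
      using M_add[of "c *\<^sub>O lreg g" a n] add(1) ring_sub
      by (auto simp: M_scale lreg_in_reduced_group_cstar cstar_subalgebraD(6)[OF A])
    have "(\<lambda>n. cmod c * M (lreg g) n + M a n) \<longlonglongrightarrow> cmod c * 0 + 0"
      using gen[of g] add.IH by (intro tendsto_intros) (simp_all add: M_def[abs_def])
    then have lim: "(\<lambda>n. cmod c * M (lreg g) n + M a n) \<longlonglongrightarrow> 0"
      by simp
    show ?case
      by (rule tendsto_sandwich[OF _ _ tendsto_const lim]) (simp_all add: M_nonneg le)
  qed
  have "M x \<longlonglongrightarrow> 0"
  proof (rule metric_LIMSEQ_I)
    fix e :: real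
    assume e: "e > 0"
    define L where "L = \<bar>K\<bar> + 1"
    have L: "L > 0" "K \<le> L"
      by (auto simp: L_def)
    obtain y where y: "y \<in> group_ring_ops" "dist y x < e / 2 / L"
      using x reduced_group_cstar_subset_closure e L(1) by (meson closure_approachable divide_pos_pos half_gt_zero subsetD)
    obtain N where N: "\<And>n. n \<ge> N \<Longrightarrow> dist (M y n) 0 < e / 2"
      using metric_LIMSEQ_D[OF ring[OF y(1)], of "e / 2"] e by auto
    have yA: "y \<in> ?A" and xy: "x - y \<in> ?A"
      using y(1) ring_sub x cstar_subalgebra_diff[OF A] by blast+
    have "M (x - y) n \<le> e / 2" for n
    proof -
      have "M (x - y) n \<le> L * norm (x - y)"
        by (rule order_trans[OF M_bound[OF xy] mult_right_mono]) (simp_all add: L)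
      also have "\<dots> \<le> L * (e / 2 / L)"
        using y(2) L(1) by (intro mult_left_mono) (simp_all add: dist_norm norm_minus_commute)
      also have "\<dots> = e / 2"
        using L(1) by simp
      finally show ?thesis .
    qed
    moreover have "M x n \<le> M (x - y) n + M y n" for n
      using M_add[OF xy yA, of n] by simp
    ultimately have "dist (M x n) 0 < e" if "n \<ge> N" for n
      using N[OF that] M_nonneg[of x n] M_nonneg[of y n] by (smt (verit) dist_real_def field_sum_of_halves)
    then show "\<exists>N. \<forall>n\<ge>N. dist (M x n) 0 < e"
      by blast
  qed
  then show ?thesis
    by (simp add: M_def[abs_def])
qed

text \<open>A sum of absolute values \<open>\<bar>a\<^sub>k\<bar>\<close> is \<open>\<Sum>k. c\<^sub>k a\<^sub>k\<close> for phases \<open>c\<^sub>k\<close>; so it is the value of the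
  state at one operator, whose norm grows only like \<open>\<surd>n\<close>.\<close>

lemma state_lreg_shifts_cesaro_null:
  assumes \<phi>: "state reduced_group_cstar \<phi>" and g: "g \<noteq> 0"
  shows "(\<lambda>n. (\<Sum>k<n. cmod (\<phi> (lreg ((free_shift ^^ k) g)))) / real n) \<longlonglongrightarrow> 0"
proof (rule tendsto_sandwich)
  let ?A = "reduced_group_cstar :: int free_group op set"
  note A = cstar_subalgebra_reduced_group_cstar
  define a where "a k = \<phi> (lreg ((free_shift ^^ k) g))" for k
  have bound: "(\<Sum>k<n. cmod (a k)) / real n \<le> 2 / sqrt (real n)" for n
  proof -
    define c where "c k = cnj (sgn (a k))" for k
    let ?s = "\<Sum>k<n. c k *\<^sub>O lreg ((free_shift ^^ k) g)"
    have c: "cmod (c k) \<le> 1" and ca: "c k * a k = complex_of_real (cmod (a k))" for k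
      by (simp add: c_def norm_sgn)
        (cases "a k = 0"; simp add: c_def sgn_eq field_simps complex_norm_square[symmetric] power2_eq_square
          mult.commute[of "cnj _"])
    have summand: "c *\<^sub>O lreg h \<in> ?A" for c h
      by (intro cstar_subalgebraD(6)[OF A] lreg_in_reduced_group_cstar)
    have zero: "\<phi> 0 = 0"
      using \<phi> cstar_subalgebraD(3)[OF A] unfolding state_def by (metis add_cancel_right_right)
    have "\<phi> (\<Sum>k\<in>F. c k *\<^sub>O lreg ((free_shift ^^ k) g)) = (\<Sum>k\<in>F. c k * a k)" if "finite F" for F
      using that
    proof (induction F rule: finite_induct)
      case (insert k F)
      have "\<phi> (c k *\<^sub>O lreg ((free_shift ^^ k) g)) = c k * a k"
        using \<phi> lreg_in_reduced_group_cstar unfolding state_def a_def by blast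
      moreover have "\<phi> (x + y) = \<phi> x + \<phi> y" if "x \<in> ?A" "y \<in> ?A" for x y
        using \<phi> that by (simp add: state_def)
      ultimately show ?case
        using insert by (simp add: summand cstar_subalgebra_sum[OF A])
    qed (simp add: zero)
    then have "\<phi> ?s = complex_of_real (\<Sum>k<n. cmod (a k))"
      by (simp add: ca)
    then have "(\<Sum>k<n. cmod (a k)) = cmod (\<phi> ?s)"
      by (simp add: sum_nonneg del: of_real_sum)
    also have "\<dots> \<le> norm ?s"
      by (intro state_le_norm[OF A id_in_reduced_group_cstar \<phi>] cstar_subalgebra_sum[OF A] summand)
    also have "\<dots> \<le> 2 * sqrt (\<Sum>k<n. (cmod (c k))\<^sup>2)"
      by (rule norm_sum_lreg_shifts[OF g])
    also have "\<dots> \<le> 2 * sqrt (real n)"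
      using sum_mono[of "{..<n}" "\<lambda>k. (cmod (c k))\<^sup>2" "\<lambda>_. 1"] c by (simp add: power_le_one)
    finally have "(\<Sum>k<n. cmod (a k)) / real n \<le> 2 * (sqrt (real n) / real n)"
      using divide_right_mono[of "\<Sum>k<n. cmod (a k)" "2 * sqrt (real n)" "real n"] by simp
    then show ?thesis
      by (simp only: sqrt_divide_self_eq[OF of_nat_0_le_iff]) (simp only: divide_inverse)
  qed
  show "\<forall>\<^sub>F n in sequentially. (\<Sum>k<n. cmod (\<phi> (lreg ((free_shift ^^ k) g)))) / real n \<le> 2 / sqrt (real n)"
    using bound by (simp add: a_def)
  show "\<forall>\<^sub>F n in sequentially. 0 \<le> (\<Sum>k<n. cmod (\<phi> (lreg ((free_shift ^^ k) g)))) / real n"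
    by (simp add: sum_nonneg)
  show "(\<lambda>n. 2 / sqrt (real n)) \<longlonglongrightarrow> 0"
    by (intro tendsto_divide_0[OF tendsto_const] filterlim_at_top_imp_at_infinity
        filterlim_compose[OF sqrt_at_top filterlim_real_sequentially])
qed simp

lemma canonical_trace_linear:
  "canonical_trace (a + b) = canonical_trace a + canonical_trace b"
  "canonical_trace (c *\<^sub>O a) = c * canonical_trace a"
  by (simp_all add: canonical_trace_def blinfun.add_left cinner_add_left cscale_op_apply cinner_cscale_left)

lemma canonical_trace_lreg: "canonical_trace (lreg g) = (if g = 0 then 1 else 0)"
  by (simp add: canonical_trace_def lreg_basis_vec cinner_basis_vec_left basis_vec.rep_eq)

lemma canonical_trace_le_norm: "cmod (canonical_trace a) \<le> norm a"
proof -
  have "cinner (basis_vec 0) (basis_vec (0::'a)) = 1"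
    by (simp add: cinner_basis_vec_left basis_vec.rep_eq)
  then have "norm (basis_vec (0::'a)) = 1"
    by (simp add: norm_eq_sqrt_inner inner_ell2_def)
  then show ?thesis
    using cmod_cinner_le[of "a (basis_vec 0)" "basis_vec 0"] norm_blinfun[of a "basis_vec 0"]
    by (simp add: canonical_trace_def)
qed

theorem corollary3p2:
  fixes \<alpha> :: "int free_group op \<Rightarrow> int free_group op"
  assumes "star_automorphism reduced_group_cstar \<alpha>"
    and "\<And>g. \<alpha> (lreg g) = lreg (free_shift g)"
  shows "strictly_weak_mixing reduced_group_cstar \<alpha> (\<lambda>x. canonical_trace x *\<^sub>O id_blinfun) \<and>
    (\<forall>x\<in>reduced_group_cstar. \<forall>\<phi>. state reduced_group_cstar \<phi> \<longrightarrow>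
       (\<lambda>n. (\<Sum>k<n. cmod (\<phi> ((\<alpha> ^^ k) x) - canonical_trace x)) / real n) \<longlonglongrightarrow> 0)"
proof -
  let ?A = "reduced_group_cstar :: int free_group op set"
  have A: "cstar_subalgebra ?A" and id: "id_blinfun \<in> ?A"
    by (rule cstar_subalgebra_reduced_group_cstar, rule id_in_reduced_group_cstar)
  have shift_zero: "(free_shift ^^ k) 0 = 0" for k
    by (induction k) (simp_all add: hom_zero_minus(1)[of free_shift, OF free_shift_add])
  have unital: "\<alpha> id_blinfun = id_blinfun"
    using assms(2)[of 0] shift_zero[of 1] by (simp add: lreg_zero)
  have pow: "(\<alpha> ^^ k) (lreg g) = lreg ((free_shift ^^ k) g)" for k g
    by (induction k) (simp_all add: assms(2))
  have mixing: "(\<lambda>n. (\<Sum>k<n. cmod (\<phi> ((\<alpha> ^^ k) x) - canonical_trace x)) / real n) \<longlonglongrightarrow> 0"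
    if x: "x \<in> ?A" and \<phi>: "state ?A \<phi>" for x \<phi>
  proof (rule cesaro_null_of_generators[where K = 2 and \<psi> = "\<lambda>k y. \<phi> ((\<alpha> ^^ k) y) - canonical_trace y", OF _ _ _ _ x])
    fix k c y z
    assume y: "y \<in> ?A"
    have \<phi>k: "state ?A (\<lambda>x. \<phi> ((\<alpha> ^^ k) x))" for k
      by (rule state_comp_funpow[OF A assms(1) unital \<phi>])
    show "\<phi> ((\<alpha> ^^ k) (c *\<^sub>O y)) - canonical_trace (c *\<^sub>O y) = c * (\<phi> ((\<alpha> ^^ k) y) - canonical_trace y)"
      using \<phi>k[of k] y by (simp add: state_def canonical_trace_linear algebra_simps)
    show "cmod (\<phi> ((\<alpha> ^^ k) y) - canonical_trace y) \<le> 2 * norm y"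
      using norm_triangle_ineq4[of "\<phi> ((\<alpha> ^^ k) y)" "canonical_trace y"]
        state_le_norm[OF A id \<phi>k[of k] y] canonical_trace_le_norm[of y] by linarith
    assume z: "z \<in> ?A"
    show "\<phi> ((\<alpha> ^^ k) (y + z)) - canonical_trace (y + z) =
        \<phi> ((\<alpha> ^^ k) y) - canonical_trace y + (\<phi> ((\<alpha> ^^ k) z) - canonical_trace z)"
      using \<phi>k[of k] y z by (simp add: state_def canonical_trace_linear)
  next
    fix g
    show "(\<lambda>n. (\<Sum>k<n. cmod (\<phi> ((\<alpha> ^^ k) (lreg g)) - canonical_trace (lreg g))) / real n) \<longlonglongrightarrow> 0"
    proof (cases "g = 0")
      case True
      have "\<phi> id_blinfun = 1" "(\<alpha> ^^ k) id_blinfun = id_blinfun" for k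
        using \<phi> pow[of k 0] by (simp_all add: state_def shift_zero lreg_zero)
      with True show ?thesis
        using canonical_trace_lreg[of "0 :: int free_group"] by (simp add: lreg_zero)
    next
      case False
      then show ?thesis
        using state_lreg_shifts_cesaro_null[OF \<phi> False] by (simp add: pow canonical_trace_lreg)
    qed
  qed
  have value_at_F: "\<phi> (canonical_trace x *\<^sub>O id_blinfun) = canonical_trace x" if "state ?A \<phi>" for \<phi> x
    using that id by (simp add: state_def)
  have F: "alg_linear ?A (\<lambda>x. canonical_trace x *\<^sub>O id_blinfun)"
  proof -
    have "cscale (c + d) v = cscale c v + cscale d v" for c d and v :: "int free_group ell2"
      by transfer (simp add: algebra_simps)
    then have "(c + d) *\<^sub>O id_blinfun = c *\<^sub>O id_blinfun + d *\<^sub>O (id_blinfun :: int free_group op)" for c d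
      by (intro blinfun_eqI) (simp add: cscale_op_apply blinfun.add_left)
    then show ?thesis
      by (simp add: alg_linear_def canonical_trace_linear cscale_op_cscale_op cstar_subalgebraD(6)[OF A id])
  qed
  show ?thesis
    unfolding strictly_weak_mixing_def
  proof (intro conjI ballI allI impI)
    fix x \<phi>
    assume x: "x \<in> ?A" and \<phi>: "state ?A \<phi>"
    show "(\<lambda>n. (\<Sum>k<n. cmod (\<phi> ((\<alpha> ^^ k) x) - canonical_trace x)) / real n) \<longlonglongrightarrow> 0"
      by (rule mixing[OF x \<phi>])
    then show "(\<lambda>n. (\<Sum>k<n. cmod (\<phi> ((\<alpha> ^^ k) x) - \<phi> (canonical_trace x *\<^sub>O id_blinfun))) / real n) \<longlonglongrightarrow> 0"
      by (simp only: value_at_F[OF \<phi>])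
  qed (use A id unital F star_automorphism_completely_positive[OF A assms(1)] in simp_all)
qed

end
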